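(* Let $2/3<\rho<1$, let $\eta_0$ be distributed according to the Bernoulli product measure $\mu^{(\rho)}$ of density $\rho$ on $\{0,1\}^{\mathbb Z}$, and let $\eta_\infty=\lim_{t\to\infty}\eta_t$ be the ($\mu^{(\rho)}$-a.s. existing) limit under the high-density moving-frame F-TASEP dynamics. Let $\mu^*$ be $\mu^{(\rho)}$ conditioned on $\{\eta_0: 0\in Q(\eta_0)\}$, let $g(k)=\mu^{(\rho)}(\eta_\infty(0)\eta_\infty(k))$ and $g^T(k)=g(k)-\rho^2$. Then: (a) For any $i\in\mathbb Z$, $\mu^{(\rho)}(\{i\in Q(\eta_0)\})=3\rho-2$. (b) For any $n\ge1$, $\mu^*(\{3n\in Q(\eta_0)\})=\mu^*(\{3n+1\in Q(\eta_0)\})$. (c) For any $n\ge0$, $\mu^*(\{\eta_\infty(3n+1)=1\})=\rho$. (d) For any $n\ge1$, $g(3n-2)+g(3n-1)+g(3n)=3\rho^2$. (e) Let $\alpha_0^*:=\bigl(27\rho^2(1-\rho)/4\bigr)^{1/3}<1$. Then for any $\alpha^*>\alpha^*_0$ there is a $C_{\alpha^*}>0$ such that $|g^T(k)|\le C_{\alpha^*}(\alpha^{*})^{k}$ for all integers $k\ge0$. (f) Let $S_L=\sum_{i=1}^L\eta_\infty(i)$ and $V_L=\operatorname{Var}(S_L)=\mu^{(\rho)}(S_L^2)-(\rho L)^2$. Then $\lim_{L\to\infty}V_L/L=\rho(1-\rho)$.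
   Context: $X=\{0,1\}^{\mathbb Z}$ ($1$ = particle, $0$ = hole). F-TASEP step $U:X\to X$: simultaneously, every particle at a site $j$ with $\eta(j-1)=1$ and $\eta(j+1)=0$ moves to $j+1$. High-density moving-frame dynamics: $\eta_{t+1}=\tau U\eta_t$, where $(\tau\eta)(k)=\eta(k-1)$. For $\mu^{(\rho)}$-a.e. $\eta_0$ with $2/3<\rho<1$, each $\eta_t(i)$ is eventually constant in $t$, so $\eta_\infty$ is defined pointwise as a function of $\eta_0$. For a configuration $\eta_0$, $h_0:\mathbb Z\to\mathbb Z$ is defined by $h_0(0)=0$, $h_0(k)-h_0(k-1)=(-1)^{\eta_0(k)}$; $h_0^*(k)=h_0(k)+k/3$; and $Q(\eta_0)=\{q\in\mathbb Z: h_0^*(q)<\inf_{i<q}h_0^*(i)\}$. $\lambda(F)$ denotes the expectation of $F$ under a measure $\lambda$. *)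

theory Defs
  imports "HOL-Probability.Probability"
begin

type_synonym config = "int \<Rightarrow> bool"

definition jumps :: "config \<Rightarrow> int \<Rightarrow> bool" where
  "jumps \<eta> j \<longleftrightarrow> \<eta> j \<and> \<eta> (j - 1) \<and> \<not> \<eta> (j + 1)"

definition ftasep_step :: "config \<Rightarrow> config" where
  "ftasep_step \<eta> j = (if jumps \<eta> (j - 1) then True else if jumps \<eta> j then False else \<eta> j)"

definition shift :: "config \<Rightarrow> config" where
  "shift \<eta> k = \<eta> (k - 1)"

definition evolve :: "nat \<Rightarrow> config \<Rightarrow> config" where
  "evolve t \<eta> = ((shift \<circ> ftasep_step) ^^ t) \<eta>"

definition site_converges :: "config \<Rightarrow> int \<Rightarrow> bool" where
  "site_converges \<eta> i \<longleftrightarrow> (\<exists>b. \<forall>\<^sub>F t in sequentially. evolve t \<eta> i = b)"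

(* The pointwise limit wherever site_converges holds; a site that does not converge
   gets the value False by convention. *)
definition eta_inf :: "config \<Rightarrow> config" where
  "eta_inf \<eta> i \<longleftrightarrow> (\<forall>\<^sub>F t in sequentially. evolve t \<eta> i)"

lemma eta_inf_eqI:
  assumes "\<forall>\<^sub>F t in sequentially. evolve t \<eta> i = b"
  shows "eta_inf \<eta> i = b"
proof (cases b)
  case True
  then show ?thesis using assms by (simp add: eta_inf_def)
next
  case False
  have "\<not> (\<forall>\<^sub>F t in sequentially. evolve t \<eta> i)"
  proof
    assume "\<forall>\<^sub>F t in sequentially. evolve t \<eta> i"
    with assms have "\<forall>\<^sub>F t in sequentially. False"
      by eventually_elim (use False in simp)
    then show False by simp
  qed
  with False show ?thesis by (simp add: eta_inf_def)
qed

(* Closed form of the two-sided recursion height_0, height_step below: for k \<ge> 0 only the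
   first sum is nonempty, for k \<le> 0 only the second. *)
definition height :: "config \<Rightarrow> int \<Rightarrow> int" where
  "height \<eta> k = (\<Sum>j\<in>{1..k}. (- 1) ^ of_bool (\<eta> j)) - (\<Sum>j\<in>{k + 1..0}. (- 1) ^ of_bool (\<eta> j))"

lemma height_0: "height \<eta> 0 = 0"
  by (simp add: height_def)

lemma height_step: "height \<eta> k - height \<eta> (k - 1) = (- 1) ^ of_bool (\<eta> k)"
proof (cases "k \<ge> 1")
  case True
  then have "{1..k} = insert k {1..k - 1}" by auto
  with True show ?thesis by (simp add: height_def)
next
  case False
  then have "{k..0} = insert k {k + 1..0}" by auto
  with False show ?thesis by (simp add: height_def)
qed

definition tilted_height :: "config \<Rightarrow> int \<Rightarrow> real" where
  "tilted_height \<eta> k = of_int (height \<eta> k) + of_int k / 3"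

(* The infimum is taken in ereal, so that it is minus infinity (and not an unspecified real)
   when the tilted height is unbounded below to the left of q. *)
definition Q :: "config \<Rightarrow> int set" where
  "Q \<eta> = {q. ereal (tilted_height \<eta> q) < (INF i\<in>{..<q}. ereal (tilted_height \<eta> i))}"

definition bernoulli :: "real \<Rightarrow> config measure" where
  "bernoulli \<rho> = Pi\<^sub>M UNIV (\<lambda>_. measure_pmf (bernoulli_pmf \<rho>))"

definition bernoulli_cond :: "real \<Rightarrow> config measure" where
  "bernoulli_cond \<rho> = uniform_measure (bernoulli \<rho>) {\<eta>. 0 \<in> Q \<eta>}"

definition two_point :: "real \<Rightarrow> int \<Rightarrow> real" where
  "two_point \<rho> k = (\<integral>\<eta>. of_bool (eta_inf \<eta> 0) * of_bool (eta_inf \<eta> k) \<partial>bernoulli \<rho>)"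

definition two_point_trunc :: "real \<Rightarrow> int \<Rightarrow> real" where
  "two_point_trunc \<rho> k = two_point \<rho> k - \<rho>\<^sup>2"

definition box_count :: "nat \<Rightarrow> config \<Rightarrow> real" where
  "box_count L \<eta> = (\<Sum>i=1..int L. of_bool (eta_inf \<eta> i))"

definition box_var :: "real \<Rightarrow> nat \<Rightarrow> real" where
  "box_var \<rho> L = prob_space.variance (bernoulli \<rho>) (box_count L)"

definition decay_rate :: "real \<Rightarrow> real" where
  "decay_rate \<rho> = root 3 (27 * \<rho>\<^sup>2 * (1 - \<rho>) / 4)"

end

theory Submission
  imports Defs
begin

text \<open>
  Let \<open>N\<close> count holes and let \<open>W k = 3 N k - k\<close>, a walk with steps \<open>+2\<close> at holes and \<open>-1\<close> at
  particles, so that \<open>Q\<close> is the set of its strict record minima. In the moving frame each hole queues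
  up behind its predecessor with a service time of three sites, and the hole count of the limit is
  \<open>min_i (N (k - 3 i) + i)\<close>. Hence any three consecutive sites of the limit carry exactly one hole,
  unless the last of them lies in \<open>Q\<close>, in which case they carry none. The limit has density \<open>\<rho>\<close> by
  translation invariance, which gives (a). Conditionally on \<open>0 \<in> Q\<close>, the probability of \<open>k \<in> Q\<close> is
  that of \<open>W\<close> being positive on \<open>[-k, -1]\<close>; since \<open>W k\<close> is congruent to \<open>-k\<close> modulo 3 and drops
  by at most 2 in one step to the left, \<open>3 n\<close> and \<open>3 n + 1\<close> give the same event, which is (b). The
  three-site identity turns (b) into recursions with period 3 that yield (c) and (d). For (e), the
  limit at \<open>k\<close> depends on sites up to 0 only if \<open>W\<close> rises between some \<open>j \<le> 0\<close> and \<open>k\<close> or \<open>k - 1\<close>, and the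
  optimal Chernoff bound for this is \<open>decay_rate \<rho>\<close>. Finally (d) and (e) make the partial sums of
  the truncated correlations exponentially small, which gives (f).
\<close>

subsection \<open>The dynamics in terms of hole counts\<close>

definition hole_count :: "config \<Rightarrow> int \<Rightarrow> int" where
  "hole_count \<eta> k = (\<Sum>j\<in>{1..k}. of_bool (\<not> \<eta> j)) - (\<Sum>j\<in>{k + 1..0}. of_bool (\<not> \<eta> j))"

definition walk :: "config \<Rightarrow> int \<Rightarrow> int" where
  "walk \<eta> k = 3 * hole_count \<eta> k - k"

lemma hole_count_0 [simp]: "hole_count \<eta> 0 = 0"
  by (simp add: hole_count_def)

lemma hole_count_step: "hole_count \<eta> k = hole_count \<eta> (k - 1) + of_bool (\<not> \<eta> k)"
proof (cases "k \<ge> 1")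
  case True
  then have "{1..k} = insert k {1..k - 1}" by auto
  with True show ?thesis by (simp add: hole_count_def)
next
  case False
  then have "{k..0} = insert k {k + 1..0}" by auto
  with False show ?thesis by (simp add: hole_count_def)
qed

lemma int_function_eqI:
  fixes f g :: "int \<Rightarrow> int"
  assumes "f 0 = g 0" and "\<And>k. f k - f (k - 1) = g k - g (k - 1)"
  shows "f k = g k"
proof (induction k rule: int_induct[where k = 0])
  case (step1 i)
  then show ?case using assms(2)[of "i + 1"] by simp
next
  case (step2 i)
  then show ?case using assms(2)[of i] by simp
qed (use assms in simp)

lemma walk_step: "walk \<eta> k = walk \<eta> (k - 1) + (if \<eta> k then - 1 else 2)"
  using hole_count_step[of \<eta> k] by (simp add: walk_def)

lemma walk_0 [simp]: "walk \<eta> 0 = 0"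
  by (simp add: walk_def)

lemma walk_mod_3: "walk \<eta> k mod 3 = (- k) mod 3"
  using mod_mult_self2[of "- k" 3 "hole_count \<eta> k"] by (simp add: walk_def)

text \<open>The height is \<open>2 * hole_count - k\<close>, so adding the tilt gives two thirds of
  an integer walk. Records can therefore be compared in integers.\<close>

lemma tilted_height_walk: "tilted_height \<eta> k = 2 / 3 * of_int (walk \<eta> k)"
proof -
  have "height \<eta> k = 2 * hole_count \<eta> k - k"
  proof (rule int_function_eqI[of "height \<eta>" "\<lambda>k. 2 * hole_count \<eta> k - k"])
    fix k show "height \<eta> k - height \<eta> (k - 1)
      = 2 * hole_count \<eta> k - k - (2 * hole_count \<eta> (k - 1) - (k - 1))"
      using height_step[of \<eta> k] hole_count_step[of \<eta> k] by simp
  qed (simp add: height_0)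
  then show ?thesis by (simp add: tilted_height_def walk_def algebra_simps)
qed

text \<open>Lying strictly below an infimum is in general stronger than lying strictly below every
  value. Since \<open>walk\<close> takes integer values, a gap of 1, that is \<open>2 / 3\<close> in
  tilted height, survives the infimum.\<close>

lemma Q_iff: "q \<in> Q \<eta> \<longleftrightarrow> (\<forall>i<q. walk \<eta> q < walk \<eta> i)"
proof
  assume q: "q \<in> Q \<eta>"
  show "\<forall>i<q. walk \<eta> q < walk \<eta> i"
  proof safe
    fix i assume "i < q"
    then have "(INF i\<in>{..<q}. ereal (tilted_height \<eta> i)) \<le> ereal (tilted_height \<eta> i)"
      by (intro INF_lower) simp
    with q have "ereal (tilted_height \<eta> q) < ereal (tilted_height \<eta> i)"
      unfolding Q_def by (blast intro: less_le_trans)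
    then show "walk \<eta> q < walk \<eta> i" by (simp add: tilted_height_walk)
  qed
next
  assume *: "\<forall>i<q. walk \<eta> q < walk \<eta> i"
  have "ereal (tilted_height \<eta> q + 2 / 3) \<le> (INF i\<in>{..<q}. ereal (tilted_height \<eta> i))"
  proof (intro INF_greatest)
    fix i assume "i \<in> {..<q}"
    with * have "walk \<eta> q + 1 \<le> walk \<eta> i" by force
    then have "real_of_int (walk \<eta> q) + 1 \<le> of_int (walk \<eta> i)" by linarith
    then show "ereal (tilted_height \<eta> q + 2 / 3) \<le> ereal (tilted_height \<eta> i)"
      by (simp add: tilted_height_walk)
  qed
  then show "q \<in> Q \<eta>"
    unfolding Q_def by (auto intro: less_le_trans[rotated])
qed

text \<open>In the moving frame a hole stays put iff its two left neighbours are particles and moves one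
  site to the right otherwise; the subtracted term is the indicator that a hole leaves \<open>{..k}\<close>.\<close>

fun count_at :: "config \<Rightarrow> nat \<Rightarrow> int \<Rightarrow> int" where
  "count_at \<eta> 0 k = hole_count \<eta> k"
| "count_at \<eta> (Suc t) k = count_at \<eta> t k - of_bool
     (count_at \<eta> t k = count_at \<eta> t (k - 1) + 1 \<and> count_at \<eta> t (k - 3) < count_at \<eta> t (k - 1))"

lemma evolve_Suc: "evolve (Suc t) \<eta> i = ftasep_step (evolve t \<eta>) (i - 1)"
  by (simp add: evolve_def shift_def)

text \<open>The new increment and the new occupation at \<open>k\<close> are both determined by the
  old occupation of the sites \<open>k - 3\<close> to \<open>k\<close>, which leaves a finite case
  check.\<close>

lemma count_at_step:
  "count_at \<eta> t k = count_at \<eta> t (k - 1) + of_bool (\<not> evolve t \<eta> k)"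
proof (induction t arbitrary: k)
  case 0
  then show ?case by (simp add: hole_count_step[of \<eta> k] evolve_def)
next
  case (Suc t)
  have 1: "count_at \<eta> t k = count_at \<eta> t (k - 1) + of_bool (\<not> evolve t \<eta> k)"
    "count_at \<eta> t (k - 1) = count_at \<eta> t (k - 2) + of_bool (\<not> evolve t \<eta> (k - 1))"
    "count_at \<eta> t (k - 2) = count_at \<eta> t (k - 3) + of_bool (\<not> evolve t \<eta> (k - 2))"
    "count_at \<eta> t (k - 3) = count_at \<eta> t (k - 4) + of_bool (\<not> evolve t \<eta> (k - 3))"
    using Suc[of k] Suc[of "k - 1"] Suc[of "k - 2"] Suc[of "k - 3"] by simp_all
  show ?case
    by (cases "evolve t \<eta> k"; cases "evolve t \<eta> (k - 1)"; cases "evolve t \<eta> (k - 2)";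
        cases "evolve t \<eta> (k - 3)")
       (insert 1, simp_all add: evolve_Suc ftasep_step_def jumps_def)
qed

section \<open>Convergence of the hole counts to an infimum formula\<close>

definition bounded_left :: "config \<Rightarrow> bool" where
  "bounded_left \<eta> \<longleftrightarrow> (\<exists>B. \<forall>i\<le>0. B \<le> walk \<eta> i)"

text \<open>Under \<open>bounded_left\<close> this is the largest function that lies below
  \<open>hole_count\<close> and grows by at most 1 over three sites. Without a lower bound the
  integer infimum has no meaning.\<close>

definition final_count :: "config \<Rightarrow> int \<Rightarrow> int" where
  "final_count \<eta> k = (INF i::nat. hole_count \<eta> (k - 3 * int i) + int i)"

lemma bounded_left_bdd:
  assumes "bounded_left \<eta>"
  shows "bdd_below (range (\<lambda>i::nat. hole_count \<eta> (k - 3 * int i) + int i))"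
proof -
  obtain B where B: "\<And>i. i \<le> 0 \<Longrightarrow> B \<le> walk \<eta> i"
    using assms by (auto simp: bounded_left_def)
  define B' where "B' = Min (insert B (walk \<eta> ` {0..k}))"
  have "B' \<le> walk \<eta> i" if "i \<le> k" for i
  proof (cases "i \<le> 0")
    case True
    have "B' \<le> B" unfolding B'_def by (intro Min_le) auto
    with B[OF True] show ?thesis by simp
  next
    case False
    with that show ?thesis unfolding B'_def by (intro Min_le) auto
  qed
  note * = this
  \<comment> \<open>Three times the term of index \<open>i\<close> equals
    \<open>walk \<eta> (k - 3 * int i) + k\<close>, so a bound on the walk up to \<open>k\<close>
    bounds all terms.\<close>
  have "B' + k \<le> 3 * (hole_count \<eta> (k - 3 * int i) + int i)" for i
    using *[of "k - 3 * int i"] by (simp add: walk_def)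
  then have "(B' + k) div 3 \<le> hole_count \<eta> (k - 3 * int i) + int i" for i
    using zdiv_mono1[of "B' + k" "3 * (hole_count \<eta> (k - 3 * int i) + int i)" 3] by simp
  then show ?thesis by (auto intro!: bdd_belowI)
qed

lemma final_count_le:
  "bounded_left \<eta> \<Longrightarrow> final_count \<eta> k \<le> hole_count \<eta> (k - 3 * int i) + int i"
  unfolding final_count_def by (intro cInf_lower bounded_left_bdd) auto

lemma final_count_greatest:
  "(\<And>i. c \<le> hole_count \<eta> (k - 3 * int i) + int i) \<Longrightarrow> c \<le> final_count \<eta> k"
  unfolding final_count_def by (intro cInf_greatest) auto

lemma final_count_le_hole_count: "bounded_left \<eta> \<Longrightarrow> final_count \<eta> k \<le> hole_count \<eta> k"
  using final_count_le[of \<eta> k 0] by simp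

text \<open>The terms for \<open>k - 3\<close>, raised by 1, are the terms for \<open>k\<close> of
  index at least 1.\<close>

lemma final_count_le_shift:
  assumes "bounded_left \<eta>"
  shows "final_count \<eta> k \<le> final_count \<eta> (k - 3) + 1"
proof -
  have "final_count \<eta> k - 1 \<le> final_count \<eta> (k - 3)"
  proof (rule final_count_greatest)
    fix i show "final_count \<eta> k - 1 \<le> hole_count \<eta> (k - 3 - 3 * int i) + int i"
      using final_count_le[OF assms, of k "Suc i"] by (simp add: algebra_simps)
  qed
  then show ?thesis by simp
qed

text \<open>Maximality of \<open>final_count\<close>: iterating the growth condition gives
  \<open>Z k \<le> Z (k - 3 * int i) + int i\<close>, which the bound by \<open>hole_count\<close>
  turns into a bound by every term of the infimum.\<close>

lemma final_count_unique:
  assumes "bounded_left \<eta>"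
    and "\<And>k. final_count \<eta> k \<le> Z k" "\<And>k. Z k \<le> hole_count \<eta> k" "\<And>k. Z k \<le> Z (k - 3) + 1"
  shows "Z k = final_count \<eta> k"
proof (rule antisym)
  have "Z k \<le> Z (k - 3 * int i) + int i" for i
  proof (induction i)
    case (Suc i)
    then show ?case using assms(4)[of "k - 3 * int i"] by (simp add: algebra_simps)
  qed simp
  then show "Z k \<le> final_count \<eta> k"
    using assms(3) by (intro final_count_greatest) (meson add_right_mono order_trans)
qed (rule assms(2))

text \<open>The count at \<open>k\<close> drops only if it is at least 2 above the count at
  \<open>k - 3\<close>. As \<open>final_count\<close> grows by at most 1 over these sites, the count
  at \<open>k\<close> is then strictly above it, so the barrier is never crossed.\<close>

lemma final_count_le_count_at:
  assumes "bounded_left \<eta>"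
  shows "final_count \<eta> k \<le> count_at \<eta> t k"
proof (induction t arbitrary: k)
  case 0
  then show ?case by (simp add: final_count_le_hole_count assms)
next
  case (Suc t)
  show ?case
    using Suc[of k] Suc[of "k - 3"] final_count_le_shift[OF assms, of k] by auto
qed

lemma decreasing_eventually_const:
  fixes f :: "nat \<Rightarrow> int"
  assumes "\<And>t. f (Suc t) \<le> f t" "\<And>t. B \<le> f t"
  shows "\<exists>c. \<forall>\<^sub>F t in sequentially. f t = c"
proof -
  obtain T where T: "\<And>t. nat (f T - B) \<le> nat (f t - B)"
    using ex_has_least_nat[of "\<lambda>_. True" 0 "\<lambda>t. nat (f t - B)"] by auto
  have "antimono f" by (rule decseq_SucI) (rule assms)
  have "f t = f T" if "t \<ge> T" for t
    using T[of t] antimonoD[OF \<open>antimono f\<close> that] assms(2)[of t] assms(2)[of T] by linarith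
  then show ?thesis unfolding eventually_sequentially by blast
qed

lemma count_at_eventually:
  assumes "bounded_left \<eta>"
  shows "\<forall>\<^sub>F t in sequentially. count_at \<eta> t k = final_count \<eta> k"
proof -
  have "\<exists>c. \<forall>\<^sub>F t in sequentially. count_at \<eta> t k = c" for k
    by (rule decreasing_eventually_const[where B = "final_count \<eta> k"])
       (auto simp: final_count_le_count_at assms)
  then obtain Z where Z: "\<And>k. \<forall>\<^sub>F t in sequentially. count_at \<eta> t k = Z k" by metis
  \<comment> \<open>Equality of the counts at times \<open>t\<close> and \<open>t + 1\<close> means
    that no hole leaves \<open>k\<close>: either there is no hole at \<open>k\<close>, or there is
    none at \<open>k - 1\<close> and \<open>k - 2\<close>.\<close>
  have frozen: "Z k = Z (k - 1) \<or> Z k = Z (k - 1) + 1 \<and> Z (k - 3) = Z (k - 1)" for k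
  proof -
    have "\<forall>\<^sub>F t in sequentially. count_at \<eta> (Suc t) k = Z k"
      using Z[of k] by (subst eventually_sequentially_Suc)
    with Z[of k] Z[of "k - 1"] Z[of "k - 2"] Z[of "k - 3"]
    have "\<forall>\<^sub>F t in sequentially.
      Z k = Z (k - 1) \<or> Z k = Z (k - 1) + 1 \<and> Z (k - 3) = Z (k - 1)"
    proof eventually_elim
      case (elim t)
      then show ?case
        using count_at_step[of \<eta> t k] count_at_step[of \<eta> t "k - 1"] count_at_step[of \<eta> t "k - 2"]
        by (cases "evolve t \<eta> k"; cases "evolve t \<eta> (k - 1)"; cases "evolve t \<eta> (k - 2)") auto
    qed
    then show ?thesis by simp
  qed
  have "Z k = final_count \<eta> k" for k
  proof (rule final_count_unique[OF assms])
    show "final_count \<eta> k \<le> Z k" for k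
      using eventually_happens'[OF sequentially_bot Z[of k]] final_count_le_count_at[OF assms, of k]
      by metis
    have "count_at \<eta> t k \<le> hole_count \<eta> k" for t k
      by (induction t) auto
    then show "Z k \<le> hole_count \<eta> k" for k
      using eventually_happens'[OF sequentially_bot Z[of k]] by metis
    show "Z k \<le> Z (k - 3) + 1" for k
      using frozen[of k] frozen[of "k - 1"] frozen[of "k - 2"] frozen[of "k - 3"] by (smt (verit))
  qed
  with Z show ?thesis by simp
qed

lemma evolve_eventually:
  assumes "bounded_left \<eta>"
  shows "\<forall>\<^sub>F t in sequentially. evolve t \<eta> k = (final_count \<eta> k = final_count \<eta> (k - 1))"
  using count_at_eventually[OF assms, of k] count_at_eventually[OF assms, of "k - 1"]
proof eventually_elim
  case (elim t)
  then show ?case using count_at_step[of \<eta> t k] by (auto simp: of_bool_def split: if_splits)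
qed

lemma site_converges_bounded_left: "bounded_left \<eta> \<Longrightarrow> site_converges \<eta> i"
  unfolding site_converges_def using evolve_eventually by blast

lemma final_count_step:
  assumes "bounded_left \<eta>"
  shows "final_count \<eta> k = final_count \<eta> (k - 1) + of_bool (\<not> eta_inf \<eta> k)"
proof -
  have "\<forall>\<^sub>F t in sequentially. evolve t \<eta> k = eta_inf \<eta> k"
    using evolve_eventually[OF assms, of k] eta_inf_eqI[OF evolve_eventually[OF assms, of k]]
    by simp
  with count_at_eventually[OF assms, of k] count_at_eventually[OF assms, of "k - 1"]
  have "\<forall>\<^sub>F t in sequentially. final_count \<eta> k = final_count \<eta> (k - 1) + of_bool (\<not> eta_inf \<eta> k)"
  proof eventually_elim
    case (elim t)
    then show ?case using count_at_step[of \<eta> t k] by simp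
  qed
  then show ?thesis by simp
qed

text \<open>Flatness over three sites means that the infimum at \<open>k\<close> is attained by the
  term of index 0. In terms of the walk this is a comparison along one residue class modulo 3, which
  extends to all sites since the walk falls by at most 1 per step to the right.\<close>

lemma final_count_flat_iff:
  assumes "bounded_left \<eta>"
  shows "final_count \<eta> k = final_count \<eta> (k - 3) \<longleftrightarrow> k \<in> Q \<eta>"
proof -
  have mono: "final_count \<eta> (k - 3) \<le> final_count \<eta> k"
    using final_count_step[OF assms, of k] final_count_step[OF assms, of "k - 1"]
      final_count_step[OF assms, of "k - 2"] by simp
  show ?thesis
  proof
    assume flat: "final_count \<eta> k = final_count \<eta> (k - 3)"
    have "hole_count \<eta> k \<le> final_count \<eta> k"
    proof (rule ccontr)
      assume "\<not> ?thesis"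
      \<comment> \<open>The terms of positive index exceed those of \<open>k - 3\<close> by 1, so by
        flatness they lie above the infimum. If the term of index 0 did too, the infimum would
        exceed itself.\<close>
      then have "final_count \<eta> k + 1 \<le> hole_count \<eta> (k - 3 * int i) + int i" for i
      proof (cases i)
        case (Suc j)
        then show ?thesis
          using final_count_le[OF assms, of "k - 3" j] flat by (simp add: algebra_simps)
      qed simp
      then have "final_count \<eta> k + 1 \<le> final_count \<eta> k" by (rule final_count_greatest)
      then show False by simp
    qed
    then have N: "hole_count \<eta> k \<le> hole_count \<eta> (k - 3 - 3 * int i) + int i" for i
      using flat final_count_le[OF assms, of "k - 3" i] by simp
    have "walk \<eta> k < walk \<eta> i" if "i < k" for i
    proof -
      \<comment> \<open>The site \<open>i\<close> lies \<open>2 - r\<close> steps to the right of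
        \<open>k - 3 - 3 * int j\<close>, where the walk is at least 3 higher than at
        \<open>k\<close>. These steps lose at most 2.\<close>
      define j where "j = nat ((k - 1 - i) div 3)"
      define r where "r = (k - 1 - i) mod 3"
      have "3 * int j + r = k - 1 - i" "0 \<le> r" "r \<le> 2"
        unfolding j_def r_def using that by (auto simp: pos_imp_zdiv_nonneg_iff)
      then have i: "i = k - 1 - 3 * int j - r" "0 \<le> r" "r \<le> 2" by linarith+
      have "walk \<eta> k + 3 \<le> walk \<eta> (k - 3 - 3 * int j)"
        using N[of j] by (simp add: walk_def)
      moreover have "walk \<eta> (k - 3 - 3 * int j) - (2 - r) \<le> walk \<eta> i"
      proof -
        have "r = 0 \<or> r = 1 \<or> r = 2" using i by linarith
        then show ?thesis
          using walk_step[of \<eta> "k - 1 - 3 * int j"] walk_step[of \<eta> "k - 2 - 3 * int j"] i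
          by (auto simp: algebra_simps split: if_splits)
      qed
      ultimately show ?thesis using i by linarith
    qed
    then show "k \<in> Q \<eta>" by (simp add: Q_iff)
  next
    assume Q: "k \<in> Q \<eta>"
    have "final_count \<eta> k \<le> final_count \<eta> (k - 3)"
    proof (rule final_count_greatest)
      fix i
      have "walk \<eta> k < walk \<eta> (k - 3 - 3 * int i)" using Q by (simp add: Q_iff)
      then have "hole_count \<eta> k \<le> hole_count \<eta> (k - 3 - 3 * int i) + int i"
        by (simp add: walk_def)
      with final_count_le_hole_count[OF assms, of k]
      show "final_count \<eta> k \<le> hole_count \<eta> (k - 3 - 3 * int i) + int i" by simp
    qed
    with mono show "final_count \<eta> k = final_count \<eta> (k - 3)" by simp
  qed
qed

text \<open>The increment of \<open>final_count\<close> over three sites is 0 or 1, and it is 0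
  exactly at records. The identity is real valued so that expectations can be taken.\<close>

lemma holes_in_window:
  assumes "bounded_left \<eta>"
  shows "of_bool (\<not> eta_inf \<eta> k) + of_bool (\<not> eta_inf \<eta> (k - 1)) + of_bool (\<not> eta_inf \<eta> (k - 2))
    + of_bool (k \<in> Q \<eta>) = (1::real)"
proof -
  have "final_count \<eta> (k - 3) + of_bool (\<not> eta_inf \<eta> k) + of_bool (\<not> eta_inf \<eta> (k - 1))
    + of_bool (\<not> eta_inf \<eta> (k - 2)) = final_count \<eta> k"
    using final_count_step[OF assms, of k] final_count_step[OF assms, of "k - 1"]
      final_count_step[OF assms, of "k - 2"] by simp
  with final_count_flat_iff[OF assms, of k] final_count_le_shift[OF assms, of k]
  show ?thesis by (auto simp: of_bool_def split: if_splits)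
qed

subsection \<open>Translation covariance and locality\<close>

definition translate :: "int \<Rightarrow> config \<Rightarrow> config" where
  "translate a \<eta> i = \<eta> (i + a)"

lemma evolve_translate [simp]: "evolve t (translate a \<eta>) i = evolve t \<eta> (i + a)"
proof (induction t arbitrary: i)
  case (Suc t)
  then show ?case
    by (simp add: evolve_Suc ftasep_step_def jumps_def algebra_simps)
qed (simp add: evolve_def translate_def)

lemma eta_inf_translate [simp]: "eta_inf (translate a \<eta>) i = eta_inf \<eta> (i + a)"
  by (simp add: eta_inf_def)

lemma walk_translate: "walk (translate a \<eta>) i = walk \<eta> (i + a) - walk \<eta> a"
proof (rule int_function_eqI[of "walk (translate a \<eta>)" "\<lambda>i. walk \<eta> (i + a) - walk \<eta> a"])
  fix k
  show "walk (translate a \<eta>) k - walk (translate a \<eta>) (k - 1)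
    = walk \<eta> (k + a) - walk \<eta> a - (walk \<eta> (k - 1 + a) - walk \<eta> a)"
    using walk_step[of "translate a \<eta>" k] walk_step[of \<eta> "k + a"]
    by (simp add: translate_def algebra_simps)
qed simp

lemma Q_translate [simp]: "i \<in> Q (translate a \<eta>) \<longleftrightarrow> i + a \<in> Q \<eta>"
proof -
  have "(\<forall>j<i. walk \<eta> (i + a) < walk \<eta> (j + a)) \<longleftrightarrow> (\<forall>j<i + a. walk \<eta> (i + a) < walk \<eta> j)"
    by (metis add_diff_cancel_right' add_less_cancel_right diff_add_cancel)
  then show ?thesis by (simp add: Q_iff walk_translate)
qed

text \<open>In the moving frame one update at \<open>k\<close> reads only the sites
  \<open>k - 3\<close> to \<open>k\<close>, so influence never travels to the left.\<close>

lemma evolve_local: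
  assumes "\<And>i. i \<le> k \<Longrightarrow> \<eta> i = \<eta>' i"
  shows "evolve t \<eta> k = evolve t \<eta>' k"
  using assms
proof (induction t arbitrary: k)
  case (Suc t)
  have "evolve t \<eta> i = evolve t \<eta>' i" if "i \<le> k" for i
    using that Suc by simp
  then show ?case by (simp add: evolve_Suc ftasep_step_def jumps_def)
qed (simp add: evolve_def)

lemma eta_inf_local: "(\<And>i. i \<le> k \<Longrightarrow> \<eta> i = \<eta>' i) \<Longrightarrow> eta_inf \<eta> k = eta_inf \<eta>' k"
  unfolding eta_inf_def using evolve_local[of k \<eta> \<eta>'] by simp

lemma hole_count_cong_right:
  assumes "\<And>i. i > 0 \<Longrightarrow> \<eta> i = \<eta>' i" and "k \<ge> 0"
  shows "hole_count \<eta> k = hole_count \<eta>' k"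
  using assms by (simp add: hole_count_def)

lemma walk_cong_right:
  "(\<And>i. i > 0 \<Longrightarrow> \<eta> i = \<eta>' i) \<Longrightarrow> k \<ge> 0 \<Longrightarrow> walk \<eta> k = walk \<eta>' k"
  unfolding walk_def using hole_count_cong_right[of \<eta> \<eta>' k] by simp

lemma walk_cong_left:
  assumes "\<And>i. i \<le> 0 \<Longrightarrow> \<eta> i = \<eta>' i" and "k \<le> 0"
  shows "walk \<eta> k = walk \<eta>' k"
  using assms by (simp add: walk_def hole_count_def)

section \<open>Records seen from the origin\<close>

lemma zero_in_Q_iff: "0 \<in> Q \<eta> \<longleftrightarrow> (\<forall>i<0. 0 < walk \<eta> i)"
  by (simp add: Q_iff)

text \<open>If 0 is a record, all sites before it lie above \<open>walk \<eta> 0\<close>, so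
  comparing with 0 disposes of them. What remains depends only on the sites 1 to \<open>k\<close>,
  which gives independence from the past.\<close>

lemma Q_iff_from_zero:
  assumes "0 \<in> Q \<eta>" and "k \<ge> 0"
  shows "k \<in> Q \<eta> \<longleftrightarrow> (\<forall>i\<in>{0..<k}. walk \<eta> k < walk \<eta> i)"
proof
  assume *: "\<forall>i\<in>{0..<k}. walk \<eta> k < walk \<eta> i"
  have "walk \<eta> k < walk \<eta> i" if "i < k" for i
  proof (cases "i < 0")
    case True
    have "k = 0 \<or> walk \<eta> k < walk \<eta> 0" using bspec[OF *, of 0] assms(2) by force
    with True assms(1) show ?thesis by (force simp: zero_in_Q_iff)
  qed (use * that in simp)
  then show "k \<in> Q \<eta>" by (simp add: Q_iff)
qed (simp add: Q_iff)

text \<open>Seen from \<open>k\<close>, this is the event that \<open>k\<close> is a strict minimum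
  of the walk over \<open>{0..k}\<close>. Anchoring it at 0 gives a family of nested events.\<close>

definition positive_before :: "int \<Rightarrow> config \<Rightarrow> bool" where
  "positive_before k \<eta> \<longleftrightarrow> (\<forall>i\<in>{- k..<0}. 0 < walk \<eta> i)"

lemma positive_before_translate:
  "positive_before k (translate k \<eta>) \<longleftrightarrow> (\<forall>i\<in>{0..<k}. walk \<eta> k < walk \<eta> i)"
proof -
  have "(\<forall>i\<in>{- k..<0}. P (i + k)) \<longleftrightarrow> (\<forall>i\<in>{0..<k}. P i)" for P
    by (force dest: bspec[where x = "_ - k"])
  from this[of "\<lambda>i. walk \<eta> k < walk \<eta> i"] show ?thesis
    by (simp add: positive_before_def walk_translate)
qed

text \<open>The walk at \<open>-3n\<close> is a multiple of 3 and drops by at most 2 in one step to the left.\<close>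

lemma positive_before_mult_3:
  assumes "n \<ge> 1"
  shows "positive_before (3 * n + 1) \<eta> \<longleftrightarrow> positive_before (3 * n) \<eta>"
proof
  assume *: "positive_before (3 * n) \<eta>"
  have "walk \<eta> (- (3 * n)) mod 3 = 0" by (simp add: walk_mod_3)
  moreover have "0 < walk \<eta> (- (3 * n))" using * assms by (simp add: positive_before_def)
  ultimately have "3 \<le> walk \<eta> (- (3 * n))" by (smt (verit) mod_pos_pos_trivial)
  then have "0 < walk \<eta> (- (3 * n) - 1)"
    using walk_step[of \<eta> "- (3 * n)"] by (simp split: if_splits)
  moreover have "i = - (3 * n) - 1 \<or> - (3 * n) \<le> i" if "- (3 * n + 1) \<le> i" for i
    using that by linarith
  ultimately show "positive_before (3 * n + 1) \<eta>"
    using * unfolding positive_before_def by (metis atLeastLessThan_iff)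
qed (simp add: positive_before_def)

lemma positive_before_1: "positive_before 1 \<eta> \<longleftrightarrow> \<eta> 0"
proof -
  have "{- 1..<0::int} = {- 1}" by auto
  then show ?thesis using walk_step[of \<eta> 0] by (auto simp: positive_before_def split: if_splits)
qed

section \<open>Replacing the left half-line by particles\<close>

definition fill_left :: "config \<Rightarrow> config" where
  "fill_left \<eta> i \<longleftrightarrow> i \<le> 0 \<or> \<eta> i"

lemma walk_fill_left: "k \<le> 0 \<Longrightarrow> walk (fill_left \<eta>) k = - k"
  using walk_cong_left[of "fill_left \<eta>" "\<lambda>_. True" k]
  by (simp add: fill_left_def) (simp add: walk_def hole_count_def)

lemma bounded_left_fill_left: "bounded_left (fill_left \<eta>)"
  unfolding bounded_left_def by (intro exI[of _ 0]) (simp add: walk_fill_left)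

text \<open>Terms that read the walk at nonnegative sites agree. If the walk of
  \<open>\<eta>'\<close> on the left half-line is not below its value at \<open>k\<close>, every
  other term for \<open>\<eta>'\<close> is at least its term of index 0, which is again common to
  both.\<close>

lemma final_count_le_if_agree:
  assumes "bounded_left \<eta>" and "k \<ge> 0"
    and "\<And>i. i > 0 \<Longrightarrow> \<eta> i = \<eta>' i" and "\<And>j. j \<le> 0 \<Longrightarrow> walk \<eta>' k \<le> walk \<eta>' j"
  shows "final_count \<eta> k \<le> final_count \<eta>' k"
proof (rule final_count_greatest)
  fix i
  show "final_count \<eta> k \<le> hole_count \<eta>' (k - 3 * int i) + int i"
  proof (cases "k - 3 * int i \<ge> 0")
    case True
    then show ?thesis
      using final_count_le[OF assms(1), of k i] hole_count_cong_right[OF assms(3)] by simp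
  next
    case False
    then have "walk \<eta>' k \<le> walk \<eta>' (k - 3 * int i)" by (intro assms(4)) simp
    then have "hole_count \<eta>' k \<le> hole_count \<eta>' (k - 3 * int i) + int i" by (simp add: walk_def)
    moreover have "final_count \<eta> k \<le> hole_count \<eta>' k"
      using final_count_le_hole_count[OF assms(1), of k] hole_count_cong_right[OF assms(3,2)]
      by simp
    ultimately show ?thesis by simp
  qed
qed

lemma final_count_fill_left:
  assumes "bounded_left \<eta>" and "k \<ge> 0" and "\<And>j. j \<le> 0 \<Longrightarrow> walk \<eta> k \<le> walk \<eta> j"
  shows "final_count (fill_left \<eta>) k = final_count \<eta> k"
proof (rule antisym)
  \<comment> \<open>The case \<open>j = 0\<close> of the hypothesis gives a nonpositive walk at
    \<open>k\<close>, while the filled walk equals \<open>- j\<close>, which is nonnegative, on the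
    left.\<close>
  have "walk (fill_left \<eta>) k \<le> walk (fill_left \<eta>) j" if "j \<le> 0" for j
    using walk_cong_right[of \<eta> "fill_left \<eta>" k] assms(2) assms(3)[of 0] that
    by (simp add: walk_fill_left) (simp add: fill_left_def)
  then show "final_count \<eta> k \<le> final_count (fill_left \<eta>) k"
    by (intro final_count_le_if_agree assms) (simp_all add: fill_left_def)
  show "final_count (fill_left \<eta>) k \<le> final_count \<eta> k"
    by (intro final_count_le_if_agree assms bounded_left_fill_left) (simp_all add: fill_left_def)
qed

text \<open>The occupation of \<open>k\<close> is read off from \<open>final_count\<close> at
  \<open>k\<close> and \<open>k - 1\<close>, which is why both sites need the comparison with the
  left half-line.\<close>

lemma eta_inf_fill_left:
  assumes "bounded_left \<eta>" and "k \<ge> 1"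
    and "\<And>j. j \<le> 0 \<Longrightarrow> walk \<eta> k \<le> walk \<eta> j" and "\<And>j. j \<le> 0 \<Longrightarrow> walk \<eta> (k - 1) \<le> walk \<eta> j"
  shows "eta_inf (fill_left \<eta>) k = eta_inf \<eta> k"
proof -
  have "final_count (fill_left \<eta>) k = final_count \<eta> k"
    "final_count (fill_left \<eta>) (k - 1) = final_count \<eta> (k - 1)"
    using assms by (simp_all add: final_count_fill_left)
  then have "of_bool (\<not> eta_inf (fill_left \<eta>) k) = (of_bool (\<not> eta_inf \<eta> k) :: int)"
    using final_count_step[OF assms(1), of k]
      final_count_step[OF bounded_left_fill_left[of \<eta>], of k] by linarith
  then show ?thesis by (simp split: split_of_bool_asm)
qed

subsection \<open>The Bernoulli measure\<close>

locale bernoulli_density =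
  fixes \<rho> :: real
  assumes rho_gt: "2 / 3 < \<rho>" and rho_lt: "\<rho> < 1"
begin

abbreviation "M \<equiv> bernoulli \<rho>"

lemma space_M [simp]: "space M = UNIV"
  by (simp add: bernoulli_def space_PiM)

sublocale prob_space M
  unfolding bernoulli_def by (intro prob_space_PiM measure_pmf.prob_space_axioms)

definition pr :: "(config \<Rightarrow> bool) \<Rightarrow> real" where
  "pr P = prob {\<eta>. P \<eta>}"

lemma site_measurable_pmf:
  "(\<lambda>\<eta>. \<eta> i) \<in> measurable M (measure_pmf (bernoulli_pmf \<rho>))"
  unfolding bernoulli_def by (rule measurable_component_singleton) simp

lemma pred_site [measurable]: "Measurable.pred M (\<lambda>\<eta>. \<eta> i)"
  using site_measurable_pmf[of i] by simp

lemma pred_evolve [measurable]: "Measurable.pred M (\<lambda>\<eta>. evolve t \<eta> i)"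
proof (induction t arbitrary: i)
  case (Suc t)
  note [measurable] = Suc
  show ?case unfolding evolve_Suc ftasep_step_def jumps_def by measurable
qed (simp add: evolve_def)

lemma pred_eta_inf [measurable]: "Measurable.pred M (\<lambda>\<eta>. eta_inf \<eta> i)"
  unfolding eta_inf_def eventually_sequentially by measurable

lemma walk_measurable [measurable]: "(\<lambda>\<eta>. real_of_int (walk \<eta> k)) \<in> borel_measurable M"
proof (induction k rule: int_induct[where k = 0])
  case (step1 i)
  note [measurable] = step1(2)
  have "(\<lambda>\<eta>. real_of_int (walk \<eta> (i + 1)))
    = (\<lambda>\<eta>. real_of_int (walk \<eta> i) + (if \<eta> (i + 1) then - 1 else 2))"
    using walk_step[of _ "i + 1"] by auto
  also have "\<dots> \<in> borel_measurable M" by measurable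
  finally show ?case .
next
  case (step2 i)
  note [measurable] = step2(2)
  have "(\<lambda>\<eta>. real_of_int (walk \<eta> (i - 1)))
    = (\<lambda>\<eta>. real_of_int (walk \<eta> i) - (if \<eta> i then - 1 else 2))"
    using walk_step[of _ i] by auto
  also have "\<dots> \<in> borel_measurable M" by measurable
  finally show ?case .
qed simp

lemma pred_walk_less [measurable]: "Measurable.pred M (\<lambda>\<eta>. walk \<eta> i < walk \<eta> j)"
  using borel_measurable_pred_less[OF walk_measurable[of i] walk_measurable[of j]] by simp

lemma pred_walk_pos [measurable]: "Measurable.pred M (\<lambda>\<eta>. 0 < walk \<eta> j)"
  using pred_walk_less[of 0 j] by simp

lemma pred_Q [measurable]: "Measurable.pred M (\<lambda>\<eta>. i \<in> Q \<eta>)"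
  unfolding Q_iff by measurable

lemma pred_positive_before [measurable]: "Measurable.pred M (positive_before k)"
  unfolding positive_before_def[abs_def] by measurable

lemma translate_measurable [measurable]: "translate a \<in> measurable M M"
proof -
  have "translate a \<in> measurable M (PiM UNIV (\<lambda>_. measure_pmf (bernoulli_pmf \<rho>)))"
  proof (rule measurable_PiM_single')
    fix i :: int
    have "Measurable.pred M (\<lambda>\<eta>. translate a \<eta> i)" unfolding translate_def by measurable
    then show "(\<lambda>\<eta>. translate a \<eta> i) \<in> measurable M (measure_pmf (bernoulli_pmf \<rho>))"
      by simp
  qed auto
  then show ?thesis by (simp only: bernoulli_def)
qed

lemma fill_left_measurable [measurable]: "fill_left \<in> measurable M M"
proof -
  have "fill_left \<in> measurable M (PiM UNIV (\<lambda>_. measure_pmf (bernoulli_pmf \<rho>)))"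
  proof (rule measurable_PiM_single')
    fix i :: int
    have "Measurable.pred M (\<lambda>\<eta>. fill_left \<eta> i)" unfolding fill_left_def by measurable
    then show "(\<lambda>\<eta>. fill_left \<eta> i) \<in> measurable M (measure_pmf (bernoulli_pmf \<rho>))"
      by simp
  qed auto
  then show ?thesis by (simp only: bernoulli_def)
qed

text \<open>All factors of the product are equal, so reindexing the coordinates along an injection
  preserves the measure.\<close>

lemma distr_translate: "distr M M (translate a) = M"
proof -
  have "inj_on (\<lambda>i::int. i + a) UNIV" by (simp add: inj_on_def)
  from distr_PiM_reindex[OF _ this, of UNIV "\<lambda>_. measure_pmf (bernoulli_pmf \<rho>)"]
  show ?thesis
    by (simp add: bernoulli_def translate_def[abs_def] restrict_UNIV measure_pmf.prob_space_axioms)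
qed

lemma pr_translate:
  assumes [measurable]: "Measurable.pred M P"
  shows "pr (\<lambda>\<eta>. P (translate a \<eta>)) = pr P"
proof -
  have "{\<eta>. P \<eta>} \<in> events" using assms by (simp add: pred_def)
  from measure_distr[OF translate_measurable this, of a]
  show ?thesis by (simp add: distr_translate pr_def vimage_def)
qed

lemma integrable_of_bool:
  assumes [measurable]: "Measurable.pred M P"
  shows "integrable M (\<lambda>\<eta>. of_bool (P \<eta>) :: real)"
  by (rule integrable_const_bound[where B = 1]) auto

lemma expectation_of_bool:
  assumes "Measurable.pred M P"
  shows "expectation (\<lambda>\<eta>. of_bool (P \<eta>)) = pr P"
proof -
  have "(\<lambda>\<eta>. of_bool (P \<eta>) :: real) = indicator {\<eta>. P \<eta>}"
    by (auto simp: indicator_def)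
  then show ?thesis by (simp add: pr_def)
qed

lemma pr_nonneg: "0 \<le> pr P"
  by (simp add: pr_def)

lemma pr_mono: "(\<And>\<eta>. P \<eta> \<Longrightarrow> R \<eta>) \<Longrightarrow> Measurable.pred M R \<Longrightarrow> pr P \<le> pr R"
  unfolding pr_def by (rule finite_measure_mono) (auto simp: pred_def)

lemma pr_split:
  assumes [measurable]: "Measurable.pred M P" "Measurable.pred M R"
  shows "pr P = pr (\<lambda>\<eta>. P \<eta> \<and> R \<eta>) + pr (\<lambda>\<eta>. P \<eta> \<and> \<not> R \<eta>)"
proof -
  have "expectation (\<lambda>\<eta>. of_bool (P \<eta>))
    = expectation (\<lambda>\<eta>. of_bool (P \<eta> \<and> R \<eta>) + of_bool (P \<eta> \<and> \<not> R \<eta>) :: real)"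
    by (rule Bochner_Integration.integral_cong) auto
  also have "\<dots> = expectation (\<lambda>\<eta>. of_bool (P \<eta> \<and> R \<eta>)) + expectation (\<lambda>\<eta>. of_bool (P \<eta> \<and> \<not> R \<eta>))"
    by (intro Bochner_Integration.integral_add integrable_of_bool) measurable
  finally show ?thesis by (subst (asm) (1 2 3) expectation_of_bool) measurable
qed

lemma pr_True [simp]: "pr (\<lambda>_. True) = 1"
  using prob_space by (simp add: pr_def)

lemma pr_not: "Measurable.pred M P \<Longrightarrow> pr (\<lambda>\<eta>. \<not> P \<eta>) = 1 - pr P"
  using pr_split[of "\<lambda>_. True" P] by simp

section \<open>Independence of the sites\<close>

lemma indep_vars_sites: "indep_vars (\<lambda>_. measure_pmf (bernoulli_pmf \<rho>)) (\<lambda>i \<eta>. \<eta> i) UNIV"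
proof (subst indep_vars_iff_distr_eq_PiM')
  have "distr M (measure_pmf (bernoulli_pmf \<rho>)) (\<lambda>\<eta>. \<eta> i) = measure_pmf (bernoulli_pmf \<rho>)" for i
    unfolding bernoulli_def by (rule distr_PiM_component) (auto intro: measure_pmf.prob_space_axioms)
  then show "distr M (Pi\<^sub>M UNIV (\<lambda>_. measure_pmf (bernoulli_pmf \<rho>))) (\<lambda>x. \<lambda>i\<in>UNIV. x i)
    = Pi\<^sub>M UNIV (\<lambda>i. distr M (measure_pmf (bernoulli_pmf \<rho>)) (\<lambda>\<eta>. \<eta> i))"
    by (simp add: bernoulli_def restrict_UNIV distr_id2)
qed (simp_all add: site_measurable_pmf)

lemma expectation_site:
  "expectation (\<lambda>\<eta>. f (\<eta> i)) = \<rho> * f True + (1 - \<rho>) * (f False :: real)"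
proof -
  have "expectation (\<lambda>\<eta>. f (\<eta> i))
    = integral\<^sup>L (distr M (measure_pmf (bernoulli_pmf \<rho>)) (\<lambda>\<eta>. \<eta> i)) f"
    by (rule integral_distr[symmetric]) (simp_all add: site_measurable_pmf)
  also have "distr M (measure_pmf (bernoulli_pmf \<rho>)) (\<lambda>\<eta>. \<eta> i) = measure_pmf (bernoulli_pmf \<rho>)"
    unfolding bernoulli_def by (rule distr_PiM_component) (auto intro: measure_pmf.prob_space_axioms)
  also have "measure_pmf.expectation (bernoulli_pmf \<rho>) f = \<rho> * f True + (1 - \<rho>) * f False"
    using rho_gt rho_lt by (simp add: integral_bernoulli_pmf)
  finally show ?thesis .
qed

lemma pr_site: "pr (\<lambda>\<eta>. \<eta> i) = \<rho>"
  using expectation_site[of of_bool i] expectation_of_bool[of "\<lambda>\<eta>. \<eta> i"] by simp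

lemma pr_indep:
  assumes P: "Measurable.pred M P" "\<And>\<eta> \<eta>'. (\<And>i. i \<le> 0 \<Longrightarrow> \<eta> i = \<eta>' i) \<Longrightarrow> P \<eta> = P \<eta>'"
    and R: "Measurable.pred M R" "\<And>\<eta> \<eta>'. (\<And>i. i > 0 \<Longrightarrow> \<eta> i = \<eta>' i) \<Longrightarrow> R \<eta> = R \<eta>'"
  shows "pr (\<lambda>\<eta>. P \<eta> \<and> R \<eta>) = pr P * pr R"
proof -
  let ?B = "measure_pmf (bernoulli_pmf \<rho>)"
  have ind: "indep_var (Pi\<^sub>M {..0} (\<lambda>_. ?B)) (\<lambda>\<eta>. restrict (\<lambda>i. \<eta> i) {..0})
      (Pi\<^sub>M {0<..} (\<lambda>_. ?B)) (\<lambda>\<eta>. restrict (\<lambda>i. \<eta> i) {0<..})"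
    by (rule indep_var_restrict[OF indep_vars_sites]) auto
  \<comment> \<open>\<open>P\<close> and \<open>R\<close> act on full configurations. Padding a
    restricted configuration with holes makes them measurable functions of their own coordinates,
    and by locality the padding does not change their values.\<close>
  have extend: "(\<lambda>\<eta> i. i \<in> S \<and> \<eta> i) \<in> measurable (Pi\<^sub>M S (\<lambda>_. ?B)) M" for S :: "int set"
  proof -
    have "(\<lambda>\<eta>. i \<in> S \<and> \<eta> i) \<in> measurable (Pi\<^sub>M S (\<lambda>_. ?B)) ?B" for i
    proof (cases "i \<in> S")
      case True
      then have "(\<lambda>\<eta>. \<eta> i) \<in> measurable (Pi\<^sub>M S (\<lambda>_. ?B)) ?B"
        by (rule measurable_component_singleton)
      with True show ?thesis by simp
    qed simp
    then show ?thesis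
      unfolding bernoulli_def by (intro measurable_PiM_single') (auto simp: space_PiM)
  qed
  have "indep_var (count_space UNIV) ((\<lambda>\<eta>. P (\<lambda>i. i \<in> {..0} \<and> \<eta> i)) \<circ> (\<lambda>\<eta>. restrict (\<lambda>i. \<eta> i) {..0}))
      (count_space UNIV) ((\<lambda>\<eta>. R (\<lambda>i. i \<in> {0<..} \<and> \<eta> i)) \<circ> (\<lambda>\<eta>. restrict (\<lambda>i. \<eta> i) {0<..}))"
    by (rule indep_var_compose[OF ind])
       (rule measurable_compose[OF extend P(1)] measurable_compose[OF extend R(1)])+
  moreover have "(\<lambda>\<eta>. P (\<lambda>i. i \<in> {..0} \<and> \<eta> i)) \<circ> (\<lambda>\<eta>. restrict (\<lambda>i. \<eta> i) {..0}) = P"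
    by (rule ext) (auto intro!: P(2))
  moreover have "(\<lambda>\<eta>. R (\<lambda>i. i \<in> {0<..} \<and> \<eta> i)) \<circ> (\<lambda>\<eta>. restrict (\<lambda>i. \<eta> i) {0<..}) = R"
    by (rule ext) (auto intro!: R(2))
  ultimately have "indep_var (count_space UNIV) P (count_space UNIV) R" by simp
  from indep_varD[OF this, of "{True}" "{True}"] show ?thesis
    by (simp add: pr_def vimage_def)
qed

end

subsection \<open>Large deviations of the walk\<close>

lemma decay_rate_pos: "0 < \<rho> \<Longrightarrow> \<rho> < 1 \<Longrightarrow> 0 < decay_rate \<rho>"
  by (simp add: decay_rate_def)

lemma decay_rate_less_1:
  assumes "2 / 3 < \<rho>"
  shows "decay_rate \<rho> < 1"
proof -
  \<comment> \<open>The cubic \<open>4 - 27 * \<rho>\<^sup>2 * (1 - \<rho>)\<close> has a double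
    root at \<open>2 / 3\<close>.\<close>
  have "0 < (3 * \<rho> - 2)\<^sup>2 * (3 * \<rho> + 1)" using assms by simp
  also have "\<dots> = 4 - 27 * \<rho>\<^sup>2 * (1 - \<rho>)" by (simp add: power2_eq_square algebra_simps)
  finally show ?thesis by (simp add: decay_rate_def)
qed

context bernoulli_density
begin

abbreviation "\<alpha> \<equiv> decay_rate \<rho>"

lemma decay_bounds: "0 < \<alpha>" "\<alpha> < 1"
  using decay_rate_pos[of \<rho>] decay_rate_less_1[of \<rho>] rho_gt rho_lt by auto

text \<open>The minimiser of the generating function \<open>\<rho> / z + (1 - \<rho>) z\<^sup>2\<close> of one step of the walk.\<close>

definition tilt :: real where "tilt = root 3 (\<rho> / (2 * (1 - \<rho>)))"

text \<open>The inequality amounts to \<open>2 / 3 \<le> \<rho>\<close>. It makes powers of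
  \<open>tilt\<close> with nonnegative exponent at least 1, as the exponential bound in
  \<open>walk_deviation\<close> requires.\<close>

lemma tilt_ge_1: "1 \<le> tilt"
  using rho_gt rho_lt by (simp add: tilt_def field_simps)

text \<open>The value of \<open>tilt ^ 3\<close> makes the second summand half of the first. The
  total is \<open>3 * \<rho> / (2 * tilt)\<close>, and its cube is the radicand of
  \<open>decay_rate\<close>.\<close>

lemma tilt_generating_function: "\<rho> / tilt + (1 - \<rho>) * tilt\<^sup>2 = \<alpha>"
proof -
  have cube: "tilt ^ 3 = \<rho> / (2 * (1 - \<rho>))"
    using rho_gt rho_lt by (simp add: tilt_def)
  have pos: "0 < tilt" using tilt_ge_1 by simp
  have "(1 - \<rho>) * tilt\<^sup>2 = (1 - \<rho>) * tilt ^ 3 / tilt"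
    using pos by (simp add: power3_eq_cube power2_eq_square)
  also have "(1 - \<rho>) * tilt ^ 3 = \<rho> / 2" using rho_lt by (simp add: cube field_simps)
  finally have "\<rho> / tilt + (1 - \<rho>) * tilt\<^sup>2 = 3 * \<rho> / (2 * tilt)" by (simp add: field_simps)
  also have "\<dots> = root 3 ((3 * \<rho> / (2 * tilt)) ^ 3)"
    using pos rho_gt by (simp add: real_root_power_cancel)
  also have "(3 * \<rho> / (2 * tilt)) ^ 3 = 27 * \<rho> ^ 3 / (8 * tilt ^ 3)"
    by (simp add: power_divide power_mult_distrib)
  also have "\<dots> = 27 * \<rho>\<^sup>2 * (1 - \<rho>) / 4"
    unfolding cube using rho_gt rho_lt by (simp add: field_simps power3_eq_cube power2_eq_square)
  finally show ?thesis by (simp add: decay_rate_def)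
qed

lemma tilted_increment:
  assumes "j \<le> k"
  shows "(\<Prod>i\<in>{j<..k}. if \<eta> i then 1 / tilt else tilt\<^sup>2)
    = tilt powr of_int (walk \<eta> k - walk \<eta> j)"
  using assms
proof (induction k rule: int_ge_induct)
  case base
  then show ?case using tilt_ge_1 by simp
next
  case (step k)
  have "{j<..k + 1} = insert (k + 1) {j<..k}" using step.hyps by auto
  with step show ?case
    using walk_step[of \<eta> "k + 1"] tilt_ge_1
    by (auto simp: powr_add[symmetric] powr_minus_divide powr_diff powr_numeral[symmetric]
        algebra_simps simp del: powr_numeral split: if_splits)
qed

text \<open>Chernoff bound: the indicator is at most \<open>tilt\<close> to the power of the
  increment, whose expectation factorises over the \<open>k - j\<close> independent steps.\<close>

lemma walk_deviation:
  assumes "j \<le> k"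
  shows "pr (\<lambda>\<eta>. walk \<eta> j \<le> walk \<eta> k) \<le> \<alpha> ^ nat (k - j)"
proof -
  let ?f = "\<lambda>b. if b then 1 / tilt else tilt\<^sup>2"
  have [measurable]: "Measurable.pred M (\<lambda>\<eta>. walk \<eta> j \<le> walk \<eta> k)"
    using pred_walk_less[of k j] by (simp add: not_less[symmetric] del: not_less)
  have "indep_vars (\<lambda>_. measure_pmf (bernoulli_pmf \<rho>)) (\<lambda>i \<eta>. \<eta> i) {j<..k}"
    using indep_vars_sites by (rule indep_vars_subset) simp
  then have ind: "indep_vars (\<lambda>_. borel) (\<lambda>i \<eta>. ?f (\<eta> i)) {j<..k}"
    by (rule indep_vars_compose2) simp
  have int: "integrable M (\<lambda>\<eta>. ?f (\<eta> i))" for i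
    by (rule integrable_const_bound[where B = "1 / tilt + tilt\<^sup>2"]) (use tilt_ge_1 in auto)
  have "pr (\<lambda>\<eta>. walk \<eta> j \<le> walk \<eta> k) = expectation (\<lambda>\<eta>. of_bool (walk \<eta> j \<le> walk \<eta> k))"
    by (simp add: expectation_of_bool)
  also have "\<dots> \<le> expectation (\<lambda>\<eta>. \<Prod>i\<in>{j<..k}. ?f (\<eta> i))"
  proof (rule integral_mono)
    show "integrable M (\<lambda>\<eta>. \<Prod>i\<in>{j<..k}. ?f (\<eta> i))"
      by (rule indep_vars_integrable[OF _ ind int]) simp
    show "of_bool (walk \<eta> j \<le> walk \<eta> k) \<le> (\<Prod>i\<in>{j<..k}. ?f (\<eta> i))" for \<eta>
      using tilt_ge_1 by (simp add: tilted_increment[OF assms] ge_one_powr_ge_zero)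
  qed (simp add: integrable_of_bool)
  also have "\<dots> = (\<Prod>i\<in>{j<..k}. expectation (\<lambda>\<eta>. ?f (\<eta> i)))"
    by (rule indep_vars_lebesgue_integral[OF _ ind int]) simp
  also have "\<dots> = (\<Prod>i\<in>{j<..k}. \<alpha>)"
    using tilt_generating_function by (subst expectation_site) simp
  finally show ?thesis by simp
qed

text \<open>By Borel-Cantelli the walk is positive at all sites far enough to the left; the finitely
  many remaining values have a minimum.\<close>

lemma AE_bounded_left: "AE \<eta> in M. bounded_left \<eta>"
proof -
  let ?A = "\<lambda>n::nat. {\<eta>. \<not> 0 < walk \<eta> (- int n)}"
  have A: "?A n \<in> events" for n
    using pred_intros_logic(2)[OF pred_walk_pos[of "- int n"]] by (simp add: pred_def)
  have "prob (?A n) \<le> \<alpha> ^ n" for n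
    using walk_deviation[of "- int n" 0] by (simp add: pr_def not_less)
  then have "summable (\<lambda>n. prob (?A n))"
    using decay_bounds by (intro summable_comparison_test'[OF summable_geometric[of \<alpha>]]) auto
  then have "AE \<eta> in M. eventually (\<lambda>n. \<eta> \<in> space M - ?A n) sequentially"
    by (intro borel_cantelli_AE1 A) (simp_all add: emeasure_eq_measure)
  then show ?thesis
  proof eventually_elim
    case (elim \<eta>)
    then obtain n0 where n0: "\<And>n. n \<ge> n0 \<Longrightarrow> 0 < walk \<eta> (- int n)"
      by (auto simp: eventually_sequentially)
    define B where "B = Min (insert 0 (walk \<eta> ` {- int n0..0}))"
    have "B \<le> walk \<eta> i" if "i \<le> 0" for i
    proof (cases "i < - int n0")
      case True
      have "B \<le> 0" unfolding B_def by (intro Min_le) auto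
      also have "0 < walk \<eta> (- int (nat (- i)))" by (rule n0) (use True in linarith)
      finally show ?thesis using that by simp
    next
      case False
      then show ?thesis unfolding B_def by (intro Min_le) (use that in auto)
    qed
    then show ?case by (auto simp: bounded_left_def)
  qed
qed

text \<open>Union bound over the starting sites \<open>- int n\<close>, each at distance
  \<open>k + n\<close> from \<open>k\<close>; the geometric series gives the factor
  \<open>1 / (1 - \<alpha>)\<close>.\<close>

lemma pr_walk_overshoot:
  assumes "k \<ge> 0"
  shows "pr (\<lambda>\<eta>. \<exists>j\<le>0. walk \<eta> j < walk \<eta> k) \<le> \<alpha> ^ nat k / (1 - \<alpha>)"
proof -
  let ?A = "\<lambda>n::nat. {\<eta>. walk \<eta> (- int n) < walk \<eta> k}"
  have A: "?A n \<in> events" for n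
    using pred_walk_less[of "- int n" k] by (simp add: pred_def)
  have le: "prob (?A n) \<le> \<alpha> ^ nat k * \<alpha> ^ n" for n
  proof -
    have [measurable]: "Measurable.pred M (\<lambda>\<eta>. walk \<eta> (- int n) \<le> walk \<eta> k)"
      using pred_walk_less[of k "- int n"] by (simp add: not_less[symmetric] del: not_less)
    have "prob (?A n) \<le> pr (\<lambda>\<eta>. walk \<eta> (- int n) \<le> walk \<eta> k)"
      unfolding pr_def[symmetric] by (rule pr_mono) auto
    also have "\<dots> \<le> \<alpha> ^ nat (k + int n)"
      using walk_deviation[of "- int n" k] assms by simp
    also have "nat (k + int n) = nat k + n" using assms by simp
    finally show ?thesis by (simp add: power_add)
  qed
  have geo: "summable (\<lambda>n. \<alpha> ^ nat k * \<alpha> ^ n)"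
    using decay_bounds by (intro summable_mult summable_geometric) simp
  have sum: "summable (\<lambda>n. prob (?A n))"
    using le by (intro summable_comparison_test'[OF geo]) auto
  have "{\<eta>. \<exists>j\<le>0. walk \<eta> j < walk \<eta> k} = (\<Union>n. ?A n)"
  proof safe
    fix \<eta> j assume "j \<le> 0" "walk \<eta> j < walk \<eta> k"
    then show "\<eta> \<in> (\<Union>n. ?A n)" by (intro UN_I[of "nat (- j)"]) auto
  next
    fix \<eta> n assume "walk \<eta> (- int n) < walk \<eta> k"
    then show "\<exists>j\<le>0. walk \<eta> j < walk \<eta> k" by (intro exI[of _ "- int n"]) simp
  qed
  then have "pr (\<lambda>\<eta>. \<exists>j\<le>0. walk \<eta> j < walk \<eta> k) = prob (\<Union>n. ?A n)" by (simp add: pr_def)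
  also have "\<dots> \<le> (\<Sum>n. prob (?A n))"
    using A by (intro finite_measure_subadditive_countably[OF _ sum]) auto
  also have "\<dots> \<le> (\<Sum>n. \<alpha> ^ nat k * \<alpha> ^ n)"
    by (rule suminf_le[OF le sum geo])
  also have "\<dots> = \<alpha> ^ nat k / (1 - \<alpha>)"
    using decay_bounds by (simp add: suminf_mult suminf_geometric summable_geometric)
  finally show ?thesis .
qed

subsection \<open>Density and decay of correlations of the limit\<close>

text \<open>Conservation of mass: the density changes by the probability of a jump into a site minus
  that of a jump out of it, and translation invariance makes the two equal.\<close>

lemma pr_evolve: "pr (\<lambda>\<eta>. evolve t \<eta> i) = \<rho>"
proof (induction t arbitrary: i)
  case 0
  then show ?case by (simp add: evolve_def pr_site)
next
  case (Suc t)
  let ?J = "\<lambda>i \<eta>. jumps (evolve t \<eta>) i"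
  have J [measurable]: "Measurable.pred M (?J i)" for i
    unfolding jumps_def by measurable
  have "(\<lambda>\<eta>. ?J 0 (translate i \<eta>)) = ?J i" for i
    by (rule ext) (simp add: jumps_def algebra_simps)
  then have J_eq: "pr (?J i) = pr (?J 0)" for i
    using pr_translate[OF J[of 0], of i] by simp
  have "pr (\<lambda>\<eta>. evolve (Suc t) \<eta> i) = expectation (\<lambda>\<eta>. of_bool (evolve (Suc t) \<eta> i))"
    by (simp add: expectation_of_bool)
  also have "\<dots> = expectation (\<lambda>\<eta>. of_bool (evolve t \<eta> (i - 1)) + of_bool (?J (i - 2) \<eta>)
      - of_bool (?J (i - 1) \<eta>))"
    by (rule Bochner_Integration.integral_cong)
       (auto simp: evolve_Suc ftasep_step_def jumps_def)
  also have "\<dots> = pr (\<lambda>\<eta>. evolve t \<eta> (i - 1)) + pr (?J (i - 2)) - pr (?J (i - 1))"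
    by (simp add: integrable_of_bool expectation_of_bool)
  also have "\<dots> = \<rho>" using Suc[of "i - 1"] J_eq[of "i - 1"] J_eq[of "i - 2"] by simp
  finally show ?case .
qed

text \<open>The density passes to the limit by dominated convergence, since the occupation of a site
  is almost surely eventually constant.\<close>

lemma pr_eta_inf: "pr (\<lambda>\<eta>. eta_inf \<eta> i) = \<rho>"
proof -
  have "(\<lambda>t. expectation (\<lambda>\<eta>. of_bool (evolve t \<eta> i) :: real))
    \<longlonglongrightarrow> expectation (\<lambda>\<eta>. of_bool (eta_inf \<eta> i))"
  proof (rule integral_dominated_convergence[where w = "\<lambda>_. 1"])
    show "AE \<eta> in M. (\<lambda>t. of_bool (evolve t \<eta> i) :: real) \<longlonglongrightarrow> of_bool (eta_inf \<eta> i)"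
      using AE_bounded_left
    proof eventually_elim
      case (elim \<eta>)
      then obtain b where b: "\<forall>\<^sub>F t in sequentially. evolve t \<eta> i = b"
        using evolve_eventually by blast
      have "\<forall>\<^sub>F t in sequentially. of_bool (evolve t \<eta> i) = (of_bool (eta_inf \<eta> i) :: real)"
        using b by eventually_elim (simp add: eta_inf_eqI[OF b])
      then show ?case by (rule tendsto_eventually)
    qed
  qed auto
  then show ?thesis
    by (simp add: expectation_of_bool pr_evolve LIMSEQ_const_iff)
qed

lemma pr_diff_le:
  assumes [measurable]: "Measurable.pred M P" "Measurable.pred M R" "Measurable.pred M B"
    and "AE \<eta> in M. P \<eta> \<noteq> R \<eta> \<longrightarrow> B \<eta>"
  shows "\<bar>pr P - pr R\<bar> \<le> pr B"
proof -
  have "pr P \<le> pr R + pr B" if "AE \<eta> in M. P \<eta> \<noteq> R \<eta> \<longrightarrow> B \<eta>"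
    and [measurable]: "Measurable.pred M P" "Measurable.pred M R" for P R
  proof -
    have "expectation (\<lambda>\<eta>. of_bool (P \<eta>))
      \<le> expectation (\<lambda>\<eta>. of_bool (R \<eta>) + of_bool (B \<eta>) :: real)"
      by (rule integral_mono_AE) (use that in \<open>auto simp: integrable_of_bool\<close>)
    then show ?thesis by (simp add: integrable_of_bool expectation_of_bool)
  qed
  moreover have "AE \<eta> in M. R \<eta> \<noteq> P \<eta> \<longrightarrow> B \<eta>" using assms(4) by eventually_elim auto
  ultimately have "pr P \<le> pr R + pr B" "pr R \<le> pr P + pr B" using assms by blast+
  then show ?thesis by linarith
qed

lemma two_point_eq_pr: "two_point \<rho> k = pr (\<lambda>\<eta>. eta_inf \<eta> 0 \<and> eta_inf \<eta> k)"
proof -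
  have "two_point \<rho> k = expectation (\<lambda>\<eta>. of_bool (eta_inf \<eta> 0 \<and> eta_inf \<eta> k))"
    unfolding two_point_def by (rule Bochner_Integration.integral_cong) auto
  then show ?thesis by (simp add: expectation_of_bool)
qed

text \<open>Up to the overshoot event, \<open>eta_inf \<eta> k\<close> is unchanged when all sites up to 0 are filled, and
  then it is independent of \<open>eta_inf \<eta> 0\<close>.\<close>

lemma two_point_decay:
  assumes "k \<ge> 1"
  shows "\<bar>two_point \<rho> k - \<rho>\<^sup>2\<bar> \<le> 4 / (\<alpha> * (1 - \<alpha>)) * \<alpha> ^ nat k"
proof -
  let ?O = "\<lambda>k \<eta>. \<exists>j\<le>0. walk \<eta> j < walk \<eta> k"
  let ?F = "\<lambda>\<eta>. eta_inf (fill_left \<eta>) k"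
  have [measurable]: "Measurable.pred M ?F"
    by (rule measurable_compose[OF fill_left_measurable pred_eta_inf])
  have O [measurable]: "Measurable.pred M (?O k)" for k by measurable
  have "pr (\<lambda>\<eta>. ?O k \<eta> \<or> ?O (k - 1) \<eta>) \<le> pr (?O k) + pr (?O (k - 1))"
    using O[of k] O[of "k - 1"] unfolding pr_def Collect_disj_eq
    by (intro measure_Un_le) (simp_all add: pred_def)
  also have "\<dots> \<le> \<alpha> ^ nat k / (1 - \<alpha>) + \<alpha> ^ nat (k - 1) / (1 - \<alpha>)"
    using assms by (intro add_mono pr_walk_overshoot) auto
  also have "\<alpha> ^ nat (k - 1) = \<alpha> ^ nat k / \<alpha>"
  proof -
    have "nat k = Suc (nat (k - 1))" using assms by simp
    then show ?thesis using decay_bounds by simp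
  qed
  also have "\<alpha> ^ nat k / (1 - \<alpha>) + \<alpha> ^ nat k / \<alpha> / (1 - \<alpha>) \<le> 2 / (\<alpha> * (1 - \<alpha>)) * \<alpha> ^ nat k"
  proof -
    have "\<alpha> ^ nat k \<le> \<alpha> ^ nat k / \<alpha>"
      using decay_bounds by (simp add: pos_le_divide_eq mult_le_cancel_left1 mult_left_le)
    then have "\<alpha> ^ nat k / (1 - \<alpha>) \<le> \<alpha> ^ nat k / \<alpha> / (1 - \<alpha>)"
      using decay_bounds by (intro divide_right_mono) auto
    then show ?thesis by simp
  qed
  finally have bound: "pr (\<lambda>\<eta>. ?O k \<eta> \<or> ?O (k - 1) \<eta>) \<le> 2 / (\<alpha> * (1 - \<alpha>)) * \<alpha> ^ nat k" .
  have AE: "AE \<eta> in M. eta_inf \<eta> k \<noteq> ?F \<eta> \<longrightarrow> ?O k \<eta> \<or> ?O (k - 1) \<eta>"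
    using AE_bounded_left
    by eventually_elim (use eta_inf_fill_left assms in \<open>meson not_less\<close>)
  have "pr (\<lambda>\<eta>. eta_inf \<eta> 0 \<and> ?F \<eta>) = pr (\<lambda>\<eta>. eta_inf \<eta> 0) * pr ?F"
  proof (rule pr_indep)
    fix \<eta> \<eta>' :: config assume "\<And>i. i > 0 \<Longrightarrow> \<eta> i = \<eta>' i"
    then show "?F \<eta> = ?F \<eta>'" by (intro eta_inf_local) (metis fill_left_def not_le)
  next
    fix \<eta> \<eta>' :: config assume "\<And>i. i \<le> 0 \<Longrightarrow> \<eta> i = \<eta>' i"
    then show "eta_inf \<eta> 0 = eta_inf \<eta>' 0" by (rule eta_inf_local)
  qed measurable
  \<comment> \<open>The overshoot probability is paid twice: here to decouple the joint event, and
    below to replace \<open>pr ?F\<close> by \<open>\<rho>\<close>. Two payments of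
    \<open>2 / (\<alpha> * (1 - \<alpha>))\<close> give the constant 4.\<close>
  moreover have "\<bar>pr (\<lambda>\<eta>. eta_inf \<eta> 0 \<and> eta_inf \<eta> k) - pr (\<lambda>\<eta>. eta_inf \<eta> 0 \<and> ?F \<eta>)\<bar>
      \<le> pr (\<lambda>\<eta>. ?O k \<eta> \<or> ?O (k - 1) \<eta>)"
    by (rule pr_diff_le) (use AE in auto)
  moreover have "\<bar>pr (\<lambda>\<eta>. eta_inf \<eta> k) - pr ?F\<bar> \<le> pr (\<lambda>\<eta>. ?O k \<eta> \<or> ?O (k - 1) \<eta>)"
    by (rule pr_diff_le) (use AE in auto)
  then have "\<rho> * \<bar>\<rho> - pr ?F\<bar> \<le> 1 * pr (\<lambda>\<eta>. ?O k \<eta> \<or> ?O (k - 1) \<eta>)"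
    unfolding pr_eta_inf using rho_gt rho_lt by (intro mult_mono) auto
  moreover have "\<rho> * \<bar>\<rho> - pr ?F\<bar> = \<bar>\<rho> * pr ?F - \<rho>\<^sup>2\<bar>"
  proof -
    have "\<rho> * \<bar>\<rho> - pr ?F\<bar> = \<bar>\<rho> * (\<rho> - pr ?F)\<bar>" using rho_gt by (simp add: abs_mult)
    then show ?thesis by (simp add: power2_eq_square right_diff_distrib abs_minus_commute)
  qed
  ultimately show ?thesis using bound by (simp add: two_point_eq_pr pr_eta_inf)
qed

subsection \<open>Conditioning on the idle sites\<close>

abbreviation "\<pi> \<equiv> 3 * \<rho> - 2"

lemma pr_holes_in_window:
  assumes [measurable]: "Measurable.pred M R"
  shows "pr (\<lambda>\<eta>. \<not> eta_inf \<eta> k \<and> R \<eta>) + pr (\<lambda>\<eta>. \<not> eta_inf \<eta> (k - 1) \<and> R \<eta>)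
    + pr (\<lambda>\<eta>. \<not> eta_inf \<eta> (k - 2) \<and> R \<eta>) + pr (\<lambda>\<eta>. k \<in> Q \<eta> \<and> R \<eta>) = pr R"
proof -
  have "pr R = expectation (\<lambda>\<eta>. of_bool (R \<eta>))" by (simp add: expectation_of_bool)
  also have "\<dots> = expectation (\<lambda>\<eta>. of_bool (\<not> eta_inf \<eta> k \<and> R \<eta>)
    + of_bool (\<not> eta_inf \<eta> (k - 1) \<and> R \<eta>) + of_bool (\<not> eta_inf \<eta> (k - 2) \<and> R \<eta>)
    + of_bool (k \<in> Q \<eta> \<and> R \<eta>))"
  proof (rule integral_cong_AE)
    show "AE \<eta> in M. of_bool (R \<eta>) = (of_bool (\<not> eta_inf \<eta> k \<and> R \<eta>)
      + of_bool (\<not> eta_inf \<eta> (k - 1) \<and> R \<eta>) + of_bool (\<not> eta_inf \<eta> (k - 2) \<and> R \<eta>)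
      + of_bool (k \<in> Q \<eta> \<and> R \<eta>) :: real)"
      using AE_bounded_left
    proof eventually_elim
      case (elim \<eta>)
      then show ?case using holes_in_window[OF elim, of k] by (cases "R \<eta>") simp_all
    qed
  qed measurable
  finally show ?thesis by (simp add: integrable_of_bool expectation_of_bool)
qed

lemma pr_not_eta_inf: "pr (\<lambda>\<eta>. \<not> eta_inf \<eta> i) = 1 - \<rho>"
  by (simp add: pr_not pr_eta_inf)

lemma pr_Q: "pr (\<lambda>\<eta>. i \<in> Q \<eta>) = \<pi>"
  using pr_holes_in_window[of "\<lambda>_. True" i] by (simp add: pr_not_eta_inf)

text \<open>For \<open>k \<ge> 0\<close> this is the conditional probability of
  \<open>k \<in> Q \<eta>\<close> given \<open>0 \<in> Q \<eta>\<close>, the renewal probability of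
  the record process, as \<open>pr_Q_Q\<close> shows.\<close>

definition idle_prob :: "int \<Rightarrow> real" where "idle_prob k = pr (positive_before k)"

text \<open>A record at 0 depends on the sites up to 0, and given it a record at \<open>k\<close>
  depends on the sites after 0. Translation by \<open>k\<close> turns the second factor into
  \<open>idle_prob k\<close>.\<close>

lemma pr_Q_Q:
  assumes "k \<ge> 0"
  shows "pr (\<lambda>\<eta>. 0 \<in> Q \<eta> \<and> k \<in> Q \<eta>) = \<pi> * idle_prob k"
proof -
  let ?R = "\<lambda>\<eta>. \<forall>i\<in>{0..<k}. walk \<eta> k < walk \<eta> i"
  have "pr (\<lambda>\<eta>. 0 \<in> Q \<eta> \<and> k \<in> Q \<eta>) = pr (\<lambda>\<eta>. 0 \<in> Q \<eta> \<and> ?R \<eta>)"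
    using Q_iff_from_zero[OF _ assms] by (intro arg_cong[where f = pr] ext) auto
  also have "\<dots> = pr (\<lambda>\<eta>. 0 \<in> Q \<eta>) * pr ?R"
  proof (rule pr_indep)
    fix \<eta> \<eta>' :: config assume "\<And>i. i \<le> 0 \<Longrightarrow> \<eta> i = \<eta>' i"
    then have "walk \<eta> i = walk \<eta>' i" if "i \<le> 0" for i
      using that by (rule walk_cong_left)
    then show "(0 \<in> Q \<eta>) = (0 \<in> Q \<eta>')" by (simp add: zero_in_Q_iff)
  next
    fix \<eta> \<eta>' :: config assume "\<And>i. i > 0 \<Longrightarrow> \<eta> i = \<eta>' i"
    then have "walk \<eta> i = walk \<eta>' i" if "i \<ge> 0" for i
      using that by (rule walk_cong_right)
    then show "?R \<eta> = ?R \<eta>'" using assms by simp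
  qed measurable
  also have "pr ?R = idle_prob k"
    using pr_translate[OF pred_positive_before, of k k]
    by (simp add: positive_before_translate idle_prob_def)
  finally show ?thesis by (simp add: pr_Q)
qed

lemma idle_prob_0: "idle_prob 0 = 1"
  by (simp add: idle_prob_def positive_before_def[abs_def])

lemma idle_prob_1: "idle_prob 1 = \<rho>"
  using pr_site[of 0] by (simp add: idle_prob_def positive_before_1[abs_def])

lemma idle_prob_mult_3: "n \<ge> 1 \<Longrightarrow> idle_prob (3 * n + 1) = idle_prob (3 * n)"
  unfolding idle_prob_def
  by (intro arg_cong[where f = pr] ext) (rule positive_before_mult_3)

text \<open>Subtracting consecutive instances of \<open>sum\<close> gives
  \<open>f (k + 3) - f k = c * (idle_prob k - idle_prob (k + 1))\<close>, which vanishes at positive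
  multiples of 3. At \<open>k = 0\<close> the three nonnegative values add up to 0, and then
  \<open>k = 1\<close> yields \<open>f 3\<close>.\<close>

lemma period_3_eq:
  fixes f :: "int \<Rightarrow> real"
  assumes sum: "\<And>k. k \<ge> 0 \<Longrightarrow> f k + f (k + 1) + f (k + 2) + c * idle_prob k = c"
    and nonneg: "\<And>k. 0 \<le> f k" and "n \<ge> 1"
  shows "f (3 * n) = c * (1 - \<rho>)"
  using \<open>n \<ge> 1\<close>
proof (induction n rule: int_ge_induct)
  case base
  have "f 1 = 0" "f 2 = 0"
    using sum[of 0] nonneg[of 0] nonneg[of 1] nonneg[of 2] by (simp_all add: idle_prob_0)
  then show ?case using sum[of 1] by (simp add: idle_prob_1 algebra_simps)
next
  case (step n)
  then show ?case
    using sum[of "3 * n"] sum[of "3 * n + 1"] idle_prob_mult_3[of n]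
    by (simp add: algebra_simps)
qed

lemma pr_hole_after_idle:
  assumes "n \<ge> 0"
  shows "pr (\<lambda>\<eta>. \<not> eta_inf \<eta> (3 * n + 1) \<and> 0 \<in> Q \<eta>) = \<pi> * (1 - \<rho>)"
proof -
  \<comment> \<open>The offset 2 lists each window from its left end, so that
    \<open>?s (3 * (n + 1))\<close> concerns the site \<open>3 * n + 1\<close>.\<close>
  let ?s = "\<lambda>k. pr (\<lambda>\<eta>. \<not> eta_inf \<eta> (k - 2) \<and> 0 \<in> Q \<eta>)"
  have "?s (3 * (n + 1)) = \<pi> * (1 - \<rho>)"
  proof (rule period_3_eq)
    fix k :: int assume "k \<ge> 0"
    then show "?s k + ?s (k + 1) + ?s (k + 2) + \<pi> * idle_prob k = \<pi>"
      using pr_holes_in_window[of "\<lambda>\<eta>. 0 \<in> Q \<eta>" k] pr_Q_Q[of k] pr_Q[of 0]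
      by (simp add: conj_commute algebra_simps)
  qed (use assms pr_nonneg in auto)
  then show ?thesis by (simp add: algebra_simps)
qed

lemma pr_hole_before_idle:
  assumes "n \<ge> 1"
  shows "pr (\<lambda>\<eta>. \<not> eta_inf \<eta> 0 \<and> 3 * n \<in> Q \<eta>) = \<pi> * (1 - \<rho>)"
proof -
  let ?r = "\<lambda>k. pr (\<lambda>\<eta>. \<not> eta_inf \<eta> 0 \<and> k \<in> Q \<eta>)"
  show ?thesis
  proof (rule period_3_eq[of ?r])
    fix k :: int assume "k \<ge> 0"
    \<comment> \<open>Moving the hole from \<open>- i\<close> to 0 moves the record from
      \<open>k\<close> to \<open>k + i\<close>, so the window ending at 0 becomes three consecutive
      values of \<open>?r\<close>.\<close>
    have "pr (\<lambda>\<eta>. \<not> eta_inf \<eta> (- i) \<and> k \<in> Q \<eta>) = ?r (k + i)" for i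
      using pr_translate[of "\<lambda>\<eta>. \<not> eta_inf \<eta> (- i) \<and> k \<in> Q \<eta>" i] by simp
    from this[of 1] this[of 2]
    show "?r k + ?r (k + 1) + ?r (k + 2) + \<pi> * idle_prob k = \<pi>"
      using pr_holes_in_window[of "\<lambda>\<eta>. k \<in> Q \<eta>" 0] pr_Q_Q[OF \<open>k \<ge> 0\<close>] pr_Q[of k]
      by simp
  qed (use assms pr_nonneg in auto)
qed

lemma prob_bernoulli_cond:
  assumes "Measurable.pred M P"
  shows "\<P>(\<eta> in bernoulli_cond \<rho>. P \<eta>) = pr (\<lambda>\<eta>. 0 \<in> Q \<eta> \<and> P \<eta>) / \<pi>"
proof -
  have "emeasure M {\<eta>. 0 \<in> Q \<eta>} = ennreal \<pi>"
    using pr_Q[of 0] by (simp add: emeasure_eq_measure pr_def)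
  then have "measure (bernoulli_cond \<rho>) {\<eta>. P \<eta>} = pr (\<lambda>\<eta>. 0 \<in> Q \<eta> \<and> P \<eta>) / \<pi>"
    using rho_gt assms pr_Q[of 0]
    unfolding bernoulli_cond_def
    by (subst measure_uniform_measure) (auto simp: pr_def pred_def Collect_conj_eq)
  then show ?thesis by (simp add: bernoulli_cond_def)
qed

text \<open>The window identity at \<open>3 * n\<close> is taken on the event of a hole at 0. Its
  record term is known from \<open>pr_hole_before_idle\<close>, and inclusion-exclusion converts
  hole pairs into particle pairs.\<close>

lemma two_point_sum:
  assumes "n \<ge> 1"
  shows "two_point \<rho> (3 * n - 2) + two_point \<rho> (3 * n - 1) + two_point \<rho> (3 * n) = 3 * \<rho>\<^sup>2"
proof -
  have hole_hole: "pr (\<lambda>\<eta>. \<not> eta_inf \<eta> k \<and> \<not> eta_inf \<eta> 0) = two_point \<rho> k + 1 - 2 * \<rho>" for k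
  proof -
    have "pr (\<lambda>\<eta>. \<not> eta_inf \<eta> k \<and> \<not> eta_inf \<eta> 0) = 1 - \<rho> - pr (\<lambda>\<eta>. \<not> eta_inf \<eta> k \<and> eta_inf \<eta> 0)"
      using pr_split[of "\<lambda>\<eta>. \<not> eta_inf \<eta> k" "\<lambda>\<eta>. eta_inf \<eta> 0"] by (simp add: pr_not_eta_inf)
    also have "pr (\<lambda>\<eta>. \<not> eta_inf \<eta> k \<and> eta_inf \<eta> 0) = \<rho> - two_point \<rho> k"
      using pr_split[of "\<lambda>\<eta>. eta_inf \<eta> 0" "\<lambda>\<eta>. eta_inf \<eta> k"]
      by (simp add: pr_eta_inf two_point_eq_pr conj_commute)
    finally show ?thesis by simp
  qed
  have "pr (\<lambda>\<eta>. 3 * n \<in> Q \<eta> \<and> \<not> eta_inf \<eta> 0) = \<pi> * (1 - \<rho>)"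
    using pr_hole_before_idle[OF assms] by (simp add: conj_commute)
  then have "two_point \<rho> (3 * n) + 1 - 2 * \<rho> + (two_point \<rho> (3 * n - 1) + 1 - 2 * \<rho>)
    + (two_point \<rho> (3 * n - 2) + 1 - 2 * \<rho>) + \<pi> * (1 - \<rho>) = 1 - \<rho>"
    using pr_holes_in_window[of "\<lambda>\<eta>. \<not> eta_inf \<eta> 0" "3 * n"]
    by (simp only: hole_hole pr_not_eta_inf)
       (simp add: hole_hole pr_not_eta_inf)
  then show ?thesis by (simp add: power2_eq_square algebra_simps)
qed

subsection \<open>The variance of the particle number in a box\<close>

lemma two_point_0: "two_point \<rho> 0 = \<rho>"
  by (simp add: two_point_eq_pr pr_eta_inf)

lemma pr_two_sites: "pr (\<lambda>\<eta>. eta_inf \<eta> i \<and> eta_inf \<eta> j) = two_point \<rho> (j - i)"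
  using pr_translate[of "\<lambda>\<eta>. eta_inf \<eta> 0 \<and> eta_inf \<eta> (j - i)" i] by (simp add: two_point_eq_pr)

lemma two_point_trunc_decay:
  obtains C where "C > 0" "\<And>k::nat. \<bar>two_point_trunc \<rho> (int k)\<bar> \<le> C * \<alpha> ^ k"
proof
  \<comment> \<open>The maximum with 1 covers \<open>k = 0\<close>, where the truncated correlation
    is \<open>\<rho> * (1 - \<rho>)\<close>.\<close>
  let ?C = "max 1 (4 / (\<alpha> * (1 - \<alpha>)))"
  show "?C > 0" by simp
  fix k :: nat
  show "\<bar>two_point_trunc \<rho> (int k)\<bar> \<le> ?C * \<alpha> ^ k"
  proof (cases "k = 0")
    case True
    have "0 \<le> \<rho> * (1 - \<rho>)" "\<rho> * (1 - \<rho>) \<le> 1"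
      using rho_gt rho_lt by (auto intro!: mult_le_one)
    with True show ?thesis
      by (simp add: two_point_trunc_def two_point_0 power2_eq_square algebra_simps)
  next
    case False
    then have "\<bar>two_point_trunc \<rho> (int k)\<bar> \<le> 4 / (\<alpha> * (1 - \<alpha>)) * \<alpha> ^ k"
      using two_point_decay[of "int k"] by (simp add: two_point_trunc_def)
    also have "\<dots> \<le> ?C * \<alpha> ^ k" using decay_bounds by (intro mult_right_mono) auto
    finally show ?thesis .
  qed
qed

lemma box_count_Suc: "box_count (Suc L) \<eta> = box_count L \<eta> + of_bool (eta_inf \<eta> (int L + 1))"
proof -
  have "{1..int (Suc L)} = insert (int L + 1) {1..int L}" by auto
  then show ?thesis by (simp add: box_count_def)
qed

lemma box_count_measurable [measurable]: "box_count L \<in> borel_measurable M"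
  unfolding box_count_def[abs_def] by measurable

lemma box_count_bounds: "0 \<le> box_count L \<eta>" "box_count L \<eta> \<le> real L"
proof -
  have "box_count L \<eta> \<le> (\<Sum>i=1..int L. 1)" unfolding box_count_def by (rule sum_mono) simp
  then show "box_count L \<eta> \<le> real L" by simp
qed (simp add: box_count_def sum_nonneg)

lemma box_count_integrable: "integrable M (box_count L)"
  by (rule integrable_const_bound[where B = "real L"]) (simp_all add: box_count_bounds)

lemma box_count_sq_integrable: "integrable M (\<lambda>\<eta>. (box_count L \<eta>)\<^sup>2)"
  by (rule integrable_const_bound[where B = "(real L)\<^sup>2"])
     (auto simp: box_count_bounds intro!: power_mono)

lemma expectation_box_count: "expectation (box_count L) = \<rho> * real L"
  unfolding box_count_def
  by (simp add: integrable_of_bool expectation_of_bool pr_eta_inf del: sum_of_bool_eq)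

lemma box_var_eq: "box_var \<rho> L = (\<integral>\<eta>. (box_count L \<eta>)\<^sup>2 \<partial>M) - (\<rho> * real L)\<^sup>2"
  unfolding box_var_def
  by (subst variance_eq) (simp_all add: box_count_integrable box_count_sq_integrable expectation_box_count)

definition trunc_sum :: "nat \<Rightarrow> real" where
  "trunc_sum L = (\<Sum>m=1..L. two_point_trunc \<rho> (int m))"

text \<open>The new site contributes its own variance and twice its covariances with the sites of
  the box, which lie at the distances 1 to \<open>L\<close>.\<close>

lemma box_var_Suc: "box_var \<rho> (Suc L) = box_var \<rho> L + \<rho> * (1 - \<rho>) + 2 * trunc_sum L"
proof -
  have "expectation (\<lambda>\<eta>. (box_count (Suc L) \<eta>)\<^sup>2) = expectation (\<lambda>\<eta>. (box_count L \<eta>)\<^sup>2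
    + 2 * (\<Sum>i=1..int L. of_bool (eta_inf \<eta> i \<and> eta_inf \<eta> (int L + 1)))
    + of_bool (eta_inf \<eta> (int L + 1)))"
  proof (rule Bochner_Integration.integral_cong[OF refl])
    fix \<eta>
    have "(\<Sum>i=1..int L. of_bool (eta_inf \<eta> i \<and> eta_inf \<eta> (int L + 1)))
      = box_count L \<eta> * of_bool (eta_inf \<eta> (int L + 1))"
      by (simp add: box_count_def sum_distrib_right of_bool_conj)
    then show "(box_count (Suc L) \<eta>)\<^sup>2 = (box_count L \<eta>)\<^sup>2
      + 2 * (\<Sum>i=1..int L. of_bool (eta_inf \<eta> i \<and> eta_inf \<eta> (int L + 1)))
      + of_bool (eta_inf \<eta> (int L + 1))"
      by (simp add: box_count_Suc power2_eq_square algebra_simps)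
  qed
  also have "\<dots> = expectation (\<lambda>\<eta>. (box_count L \<eta>)\<^sup>2)
    + 2 * (\<Sum>i=1..int L. two_point \<rho> (int L + 1 - i)) + \<rho>"
    by (simp add: box_count_sq_integrable integrable_of_bool expectation_of_bool pr_two_sites
        pr_eta_inf del: sum_of_bool_eq)
  also have "(\<Sum>i=1..int L. two_point \<rho> (int L + 1 - i)) = (\<Sum>m=1..L. two_point \<rho> (int m))"
    by (rule sum.reindex_bij_witness[of _ "\<lambda>m. int L + 1 - int m" "\<lambda>i. nat (int L + 1 - i)"]) auto
  also have "\<dots> = trunc_sum L + \<rho>\<^sup>2 * real L"
    by (simp add: trunc_sum_def two_point_trunc_def sum_subtractf)
  finally show ?thesis by (simp add: box_var_eq power2_eq_square algebra_simps)
qed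

lemma trunc_sum_mult_3: "trunc_sum (3 * n) = 0"
proof (induction n)
  case (Suc n)
  have "{1..3 * Suc n} = {1..3 * n} \<union> {3 * n + 1, 3 * n + 2, 3 * n + 3}" by auto
  with Suc two_point_sum[of "int (Suc n)"] show ?case
    by (simp add: trunc_sum_def two_point_trunc_def sum.union_disjoint algebra_simps)
qed (simp add: trunc_sum_def)

text \<open>Complete blocks of three cancel. One extra term is itself small, and two extra terms
  equal minus the term that would complete the block.\<close>

lemma trunc_sum_decay:
  obtains C where "C > 0" "\<And>m. \<bar>trunc_sum m\<bar> \<le> C * \<alpha> ^ m"
proof -
  obtain C where C: "C > 0" "\<And>k::nat. \<bar>two_point_trunc \<rho> (int k)\<bar> \<le> C * \<alpha> ^ k"
    using two_point_trunc_decay by blast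
  have Suc: "trunc_sum (Suc m) = trunc_sum m + two_point_trunc \<rho> (int (Suc m))" for m
    by (simp add: trunc_sum_def)
  have "\<bar>trunc_sum m\<bar> \<le> C * \<alpha> ^ m" for m
  proof -
    define n where "n = m div 3"
    have "m = 3 * n \<or> m = Suc (3 * n) \<or> Suc m = 3 * Suc n"
      unfolding n_def by presburger
    then consider "m = 3 * n" | "m = Suc (3 * n)" | "Suc m = 3 * Suc n" by blast
    then show ?thesis
    proof cases
      case 1
      then show ?thesis using C decay_bounds by (simp add: trunc_sum_mult_3)
    next
      case 2
      then show ?thesis using C(2)[of m] Suc[of "3 * n"] by (simp add: trunc_sum_mult_3)
    next
      case 3
      have "\<bar>trunc_sum m\<bar> = \<bar>two_point_trunc \<rho> (int (Suc m))\<bar>"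
        using Suc[of m] trunc_sum_mult_3[of "Suc n"] 3 by simp
      also have "\<dots> \<le> C * \<alpha> ^ Suc m" by (rule C(2))
      also have "\<dots> \<le> C * \<alpha> ^ m"
        using C(1) decay_bounds by (intro mult_left_mono power_decreasing) auto
      finally show ?thesis .
    qed
  qed
  with C(1) show ?thesis by (rule that)
qed

text \<open>Summing the increments, the deviation of the variance from
  \<open>\<rho> * (1 - \<rho>) * real L\<close> is twice a sum of partial sums, which a geometric
  series bounds uniformly in \<open>L\<close>.\<close>

lemma box_var_limit: "(\<lambda>L. box_var \<rho> L / real L) \<longlonglongrightarrow> \<rho> * (1 - \<rho>)"
proof -
  obtain C where C: "C > 0" "\<And>m. \<bar>trunc_sum m\<bar> \<le> C * \<alpha> ^ m"
    using trunc_sum_decay by blast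
  have "box_var \<rho> L = \<rho> * (1 - \<rho>) * real L + 2 * (\<Sum>m<L. trunc_sum m)" for L
  proof (induction L)
    case 0
    then show ?case by (simp add: box_var_eq box_count_def)
  qed (simp add: box_var_Suc algebra_simps)
  moreover have "\<bar>\<Sum>m<L. trunc_sum m\<bar> \<le> C / (1 - \<alpha>)" for L
  proof -
    have "\<bar>\<Sum>m<L. trunc_sum m\<bar> \<le> (\<Sum>m<L. C * \<alpha> ^ m)"
      by (rule order_trans[OF sum_abs sum_mono]) (rule C(2))
    also have "\<dots> \<le> (\<Sum>m. C * \<alpha> ^ m)"
      using C(1) decay_bounds
      by (intro sum_le_suminf summable_mult summable_geometric) auto
    also have "\<dots> = C / (1 - \<alpha>)"
      using decay_bounds by (simp add: suminf_mult suminf_geometric summable_geometric)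
    finally show ?thesis .
  qed
  ultimately have bound: "\<bar>box_var \<rho> L - \<rho> * (1 - \<rho>) * real L\<bar> \<le> 2 * (C / (1 - \<alpha>))" for L
    by (simp add: abs_mult del: times_divide_eq_right)
  have "(\<lambda>L. box_var \<rho> L / real L - \<rho> * (1 - \<rho>)) \<longlonglongrightarrow> 0"
  proof (rule Lim_null_comparison)
    show "\<forall>\<^sub>F L in sequentially. norm (box_var \<rho> L / real L - \<rho> * (1 - \<rho>))
      \<le> 2 * (C / (1 - \<alpha>)) / real L"
      using eventually_gt_at_top[of 0]
    proof eventually_elim
      case (elim L)
      then have "box_var \<rho> L / real L - \<rho> * (1 - \<rho>)
        = (box_var \<rho> L - \<rho> * (1 - \<rho>) * real L) / real L"
        by (simp add: field_simps)
      then show ?case using divide_right_mono[OF bound[of L], of "real L"] by simp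
    qed
    show "(\<lambda>L. 2 * (C / (1 - \<alpha>)) / real L) \<longlonglongrightarrow> 0"
      by (rule lim_const_over_n)
  qed
  then show ?thesis by (simp add: LIM_zero_iff)
qed

end

theorem theorem4p3:
  fixes \<rho> :: real
  assumes "2 / 3 < \<rho>" and "\<rho> < 1"
  shows "(AE \<eta> in bernoulli \<rho>. \<forall>i. site_converges \<eta> i)
    \<and> (\<forall>i::int. \<P>(\<eta> in bernoulli \<rho>. i \<in> Q \<eta>) = 3 * \<rho> - 2)
    \<and> (\<forall>n\<ge>1::int. \<P>(\<eta> in bernoulli_cond \<rho>. 3 * n \<in> Q \<eta>)
          = \<P>(\<eta> in bernoulli_cond \<rho>. 3 * n + 1 \<in> Q \<eta>))
    \<and> (\<forall>n\<ge>0::int. \<P>(\<eta> in bernoulli_cond \<rho>. eta_inf \<eta> (3 * n + 1)) = \<rho>)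
    \<and> (\<forall>n\<ge>1::int. two_point \<rho> (3 * n - 2) + two_point \<rho> (3 * n - 1) + two_point \<rho> (3 * n) = 3 * \<rho>\<^sup>2)
    \<and> (decay_rate \<rho> < 1
        \<and> (\<forall>\<alpha>>decay_rate \<rho>. \<exists>C>0. \<forall>k::nat. \<bar>two_point_trunc \<rho> (int k)\<bar> \<le> C * \<alpha> ^ k))
    \<and> ((\<forall>L. box_var \<rho> L = (\<integral>\<eta>. (box_count L \<eta>)\<^sup>2 \<partial>bernoulli \<rho>) - (\<rho> * real L)\<^sup>2)
        \<and> (\<lambda>L. box_var \<rho> L / real L) \<longlonglongrightarrow> \<rho> * (1 - \<rho>))"
proof -
  interpret bernoulli_density \<rho>
    using assms by unfold_locales
  show ?thesis
  proof (intro conjI allI impI)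
    show "AE \<eta> in bernoulli \<rho>. \<forall>i. site_converges \<eta> i"
      using AE_bounded_left by eventually_elim (simp add: site_converges_bounded_left)
    show "\<P>(\<eta> in bernoulli \<rho>. i \<in> Q \<eta>) = 3 * \<rho> - 2" for i
      using pr_Q[of i] by (simp add: pr_def)
    show "\<P>(\<eta> in bernoulli_cond \<rho>. 3 * n \<in> Q \<eta>)
      = \<P>(\<eta> in bernoulli_cond \<rho>. 3 * n + 1 \<in> Q \<eta>)" if "n \<ge> 1" for n
      using that by (simp add: prob_bernoulli_cond pr_Q_Q idle_prob_mult_3)
    show "\<P>(\<eta> in bernoulli_cond \<rho>. eta_inf \<eta> (3 * n + 1)) = \<rho>" if "n \<ge> 0" for n
    proof -
      \<comment> \<open>Complement of \<open>pr_hole_after_idle\<close> within the event that 0 is a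
        record.\<close>
      have "pr (\<lambda>\<eta>. 0 \<in> Q \<eta> \<and> eta_inf \<eta> (3 * n + 1)) = (3 * \<rho> - 2) * \<rho>"
        using pr_split[of "\<lambda>\<eta>. 0 \<in> Q \<eta>" "\<lambda>\<eta>. eta_inf \<eta> (3 * n + 1)"] pr_hole_after_idle[OF that]
        by (simp add: pr_Q conj_commute algebra_simps)
      then show ?thesis using assms by (simp add: prob_bernoulli_cond)
    qed
    show "decay_rate \<rho> < 1" by (rule decay_bounds)
    show "\<exists>C>0. \<forall>k::nat. \<bar>two_point_trunc \<rho> (int k)\<bar> \<le> C * \<beta> ^ k"
      if "\<beta> > decay_rate \<rho>" for \<beta>
    proof -
      obtain C where C: "C > 0" "\<And>k::nat. \<bar>two_point_trunc \<rho> (int k)\<bar> \<le> C * decay_rate \<rho> ^ k"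
        using two_point_trunc_decay by blast
      have "C * decay_rate \<rho> ^ k \<le> C * \<beta> ^ k" for k
        using that decay_bounds C(1) by (intro mult_left_mono power_mono) auto
      with C show ?thesis by (meson order_trans)
    qed
  qed (simp_all add: two_point_sum box_var_eq[symmetric] box_var_limit)
qed

end
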